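(* Let $\Sigma$ be a closed, connected, oriented surface with negative Euler characteristic and let $(g,m)$ be a minimal hyperbolic germ on $\Sigma$. Then there is a hyperbolic metric (with scalar curvature $-1$) on a neighborhood of $\Sigma\times\{0\}$ in $\Sigma\times\mathbb{R}$ whose respective first and second fundamental forms on $\Sigma\times\{0\}$ are $g$ and $m$.
   Context: For a Riemannian metric $g$ on $\Sigma$, $d_C$ denotes the Levi-Civita covariant derivative and $r$ the scalar curvature (twice the Gauss curvature); repeated indices are summed and $|m|^2$ is computed using $g$. A minimal hyperbolic germ on $\Sigma$ is a pair $(g,m)$ of a smooth Riemannian metric $g$ and a smooth symmetric section $m$ of $T^*\Sigma\otimes T^*\Sigma$ such that $$d_Cm_{AB}-d_Bm_{AC}=0,\qquad r+|m|^2+\tfrac13=0,\qquad g^{AB}m_{AB}=0.$$ A hyperbolic metric is one of constant negative sectional curvature, normalized here so that the scalar curvature is $-1$ (Ricci tensor equal to $-\frac13$ times the metric). Sign convention for the second fundamental form: for a metric $\gamma_{AB}(t,z)dz^Adz^B+dt^2$, the second fundamental form of $\{t=0\}$ is $\frac12\partial_t\gamma_{AB}|_{t=0}$. *)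

theory Defs
  imports "HOL-Analysis.Analysis" "HOL-Homology.Homology"
begin

section \<open>Smooth manifolds given by atlases\<close>

text \<open>
  A manifold is a topology on a type of points together with an atlas of charts into a Euclidean
  space. Atlases are not required to be maximal: any atlas determines the smooth structure, and a
  tensor field given in the charts of an atlas extends uniquely to the maximal atlas.
\<close>

type_synonym ('p, 'e) chart = "'p set \<times> ('p \<Rightarrow> 'e)"

abbreviation chart_dom :: "('p, 'e) chart \<Rightarrow> 'p set" where
  "chart_dom c \<equiv> fst c"

abbreviation chart_map :: "('p, 'e) chart \<Rightarrow> 'p \<Rightarrow> 'e" where
  "chart_map c \<equiv> snd c"

definition chart_range :: "('p, 'e) chart \<Rightarrow> 'e set" where
  "chart_range c = chart_map c ` chart_dom c"

definition is_chart :: "'p topology \<Rightarrow> ('p, 'e::euclidean_space) chart \<Rightarrow> bool" where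
  "is_chart X c \<longleftrightarrow>
     openin X (chart_dom c) \<and> open (chart_range c) \<and>
     homeomorphic_map (subtopology X (chart_dom c)) (top_of_set (chart_range c)) (chart_map c)"

definition transition :: "('p, 'e) chart \<Rightarrow> ('p, 'e) chart \<Rightarrow> 'e \<Rightarrow> 'e" where
  "transition c d = chart_map d \<circ> inv_into (chart_dom c) (chart_map c)"

definition overlap :: "('p, 'e) chart \<Rightarrow> ('p, 'e) chart \<Rightarrow> 'e set" where
  "overlap c d = chart_map c ` (chart_dom c \<inter> chart_dom d)"

text \<open>Continuous differentiability of finite order, intended for open sets only.\<close>

primrec Ck_on :: "nat \<Rightarrow> 'a::real_normed_vector set \<Rightarrow> ('a \<Rightarrow> 'b::real_normed_vector) \<Rightarrow> bool" where
  "Ck_on 0 S f \<longleftrightarrow> continuous_on S f"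
| "Ck_on (Suc k) S f \<longleftrightarrow>
     (\<forall>x\<in>S. f differentiable (at x)) \<and> (\<forall>v. Ck_on k S (\<lambda>x. frechet_derivative f (at x) v))"

definition smooth_on :: "'a::real_normed_vector set \<Rightarrow> ('a \<Rightarrow> 'b::real_normed_vector) \<Rightarrow> bool" where
  "smooth_on S f \<longleftrightarrow> (\<forall>k. Ck_on k S f)"

definition smooth_manifold :: "'p topology \<Rightarrow> ('p, 'e::euclidean_space) chart set \<Rightarrow> bool" where
  "smooth_manifold X A \<longleftrightarrow>
     Hausdorff_space X \<and> second_countable X \<and>
     (\<forall>c\<in>A. is_chart X c) \<and> (\<Union>c\<in>A. chart_dom c) = topspace X \<and>
     (\<forall>c\<in>A. \<forall>d\<in>A. smooth_on (overlap c d) (transition c d))"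

definition oriented_atlas :: "('p, real^'n) chart set \<Rightarrow> bool" where
  "oriented_atlas A \<longleftrightarrow>
     (\<forall>c\<in>A. \<forall>d\<in>A. \<forall>x\<in>overlap c d.
        det (matrix (frechet_derivative (transition c d) (at x))) > 0)"

definition cylinder_chart :: "('p, 'e) chart \<Rightarrow> ('p \<times> real, 'e \<times> real) chart" where
  "cylinder_chart c = (chart_dom c \<times> UNIV, map_prod (chart_map c) id)"

definition restrict_chart :: "'p set \<Rightarrow> ('p, 'e) chart \<Rightarrow> ('p, 'e) chart" where
  "restrict_chart W c = (chart_dom c \<inter> W, chart_map c)"

section \<open>Euler characteristic\<close>

text \<open>Integral linear independence in an abelian group, written multiplicatively.\<close>

definition int_independent :: "('g, 'm) monoid_scheme \<Rightarrow> 'g set \<Rightarrow> bool" where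
  "int_independent G B \<longleftrightarrow>
     B \<subseteq> carrier G \<and>
     (\<forall>n :: 'g \<Rightarrow> int. finprod G (\<lambda>b. b [^]\<^bsub>G\<^esub> n b) B = \<one>\<^bsub>G\<^esub> \<longrightarrow> (\<forall>b\<in>B. n b = 0))"

text \<open>The rank is meaningful when it is finite, as for the homology of a compact manifold.\<close>

definition abelian_rank :: "('g, 'm) monoid_scheme \<Rightarrow> nat" where
  "abelian_rank G = Sup {card B |B. finite B \<and> int_independent G B}"

definition betti :: "nat \<Rightarrow> 'p topology \<Rightarrow> nat" where
  "betti k X = abelian_rank (homology_group (int k) X)"

definition euler_characteristic :: "'p topology \<Rightarrow> int" where
  "euler_characteristic X = (\<Sum>k | betti k X \<noteq> 0. (- 1) ^ k * int (betti k X))"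

definition closed_connected_oriented_surface ::
  "'p topology \<Rightarrow> ('p, real^2) chart set \<Rightarrow> bool" where
  "closed_connected_oriented_surface X A \<longleftrightarrow>
     smooth_manifold X A \<and> oriented_atlas A \<and> compact_space X \<and> connected_space X"

section \<open>Covariant 2-tensor fields\<close>

text \<open>
  A field of bilinear forms on (an open part of) the coordinate space: base point, then two
  tangent vectors. A tensor field on a manifold assigns one to each chart.
\<close>

type_synonym 'e bform_field = "'e \<Rightarrow> 'e \<Rightarrow> 'e \<Rightarrow> real"

type_synonym ('p, 'e) tensor2 = "('p, 'e) chart \<Rightarrow> 'e bform_field"

definition smooth_tensor2 :: "('p, 'e::euclidean_space) chart set \<Rightarrow> ('p, 'e) tensor2 \<Rightarrow> bool" where
  "smooth_tensor2 A T \<longleftrightarrow>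
     (\<forall>c\<in>A. (\<forall>x\<in>chart_range c. bilinear (T c x)) \<and>
             (\<forall>u v. smooth_on (chart_range c) (\<lambda>x. T c x u v))) \<and>
     (\<forall>c\<in>A. \<forall>d\<in>A. \<forall>x\<in>overlap c d. \<forall>u v.
        T c x u v = T d (transition c d x)
          (frechet_derivative (transition c d) (at x) u)
          (frechet_derivative (transition c d) (at x) v))"

definition symmetric_tensor2 :: "('p, 'e::euclidean_space) chart set \<Rightarrow> ('p, 'e) tensor2 \<Rightarrow> bool" where
  "symmetric_tensor2 A T \<longleftrightarrow> (\<forall>c\<in>A. \<forall>x\<in>chart_range c. \<forall>u v. T c x u v = T c x v u)"

definition riemannian_metric :: "('p, 'e::euclidean_space) chart set \<Rightarrow> ('p, 'e) tensor2 \<Rightarrow> bool" where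
  "riemannian_metric A g \<longleftrightarrow>
     smooth_tensor2 A g \<and> symmetric_tensor2 A g \<and>
     (\<forall>c\<in>A. \<forall>x\<in>chart_range c. \<forall>u. u \<noteq> 0 \<longrightarrow> g c x u u > 0)"

section \<open>Riemannian geometry in coordinates\<close>

text \<open>The vector metrically dual to the covector \<open>\<alpha>\<close> at \<open>x\<close>.\<close>

definition sharp :: "'e::euclidean_space bform_field \<Rightarrow> 'e \<Rightarrow> ('e \<Rightarrow> real) \<Rightarrow> 'e" where
  "sharp g x \<alpha> = (THE w. \<forall>z. g x w z = \<alpha> z)"

text \<open>For basis vectors these are the components $g^{ij}$ of the inverse metric.\<close>

definition inverse_metric :: "'e::euclidean_space bform_field \<Rightarrow> 'e bform_field" where
  "inverse_metric g x i j = sharp g x (\<lambda>z. z \<bullet> i) \<bullet> j"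

definition metric_trace :: "'e::euclidean_space bform_field \<Rightarrow> 'e bform_field \<Rightarrow> 'e \<Rightarrow> real" where
  "metric_trace g m x = (\<Sum>i\<in>Basis. \<Sum>j\<in>Basis. inverse_metric g x i j * m x i j)"

definition tensor_norm_sq :: "'e::euclidean_space bform_field \<Rightarrow> 'e bform_field \<Rightarrow> 'e \<Rightarrow> real" where
  "tensor_norm_sq g m x =
     (\<Sum>i\<in>Basis. \<Sum>j\<in>Basis. \<Sum>k\<in>Basis. \<Sum>l\<in>Basis.
        inverse_metric g x i k * inverse_metric g x j l * m x i j * m x k l)"

text \<open>
  Koszul's formula for vector fields with constant coordinate components; on basis vectors it gives
  the vector with components $\Gamma^k_{ij}$.
\<close>

definition christoffel :: "'e::euclidean_space bform_field \<Rightarrow> 'e \<Rightarrow> 'e \<Rightarrow> 'e \<Rightarrow> 'e" where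
  "christoffel g x u v = sharp g x (\<lambda>z.
     (frechet_derivative (\<lambda>y. g y v z) (at x) u
      + frechet_derivative (\<lambda>y. g y u z) (at x) v
      - frechet_derivative (\<lambda>y. g y u v) (at x) z) / 2)"

text \<open>\<open>cov_deriv g m x w u v\<close> is $(\nabla_w m)(u, v)$.\<close>

definition cov_deriv ::
  "'e::euclidean_space bform_field \<Rightarrow> 'e bform_field \<Rightarrow> 'e \<Rightarrow> 'e \<Rightarrow> 'e \<Rightarrow> 'e \<Rightarrow> real" where
  "cov_deriv g m x w u v =
     frechet_derivative (\<lambda>y. m y u v) (at x) w
     - m x (christoffel g x w u) v - m x u (christoffel g x w v)"

text \<open>$R(u,v)w = \nabla_u\nabla_v w - \nabla_v\nabla_u w$ for constant-component fields.\<close>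

definition riemann :: "'e::euclidean_space bform_field \<Rightarrow> 'e \<Rightarrow> 'e \<Rightarrow> 'e \<Rightarrow> 'e \<Rightarrow> 'e" where
  "riemann g x u v w =
     frechet_derivative (\<lambda>y. christoffel g y v w) (at x) u
     - frechet_derivative (\<lambda>y. christoffel g y u w) (at x) v
     + christoffel g x u (christoffel g x v w)
     - christoffel g x v (christoffel g x u w)"

definition ricci :: "'e::euclidean_space bform_field \<Rightarrow> 'e bform_field" where
  "ricci g x v w = (\<Sum>i\<in>Basis. riemann g x i v w \<bullet> i)"

definition scalar_curvature :: "'e::euclidean_space bform_field \<Rightarrow> 'e \<Rightarrow> real" where
  "scalar_curvature g x = metric_trace g (ricci g) x"

definition sectional_curvature :: "'e::euclidean_space bform_field \<Rightarrow> 'e \<Rightarrow> 'e \<Rightarrow> 'e \<Rightarrow> real" where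
  "sectional_curvature g x u v =
     g x (riemann g x u v v) u / (g x u u * g x v v - (g x u v)\<^sup>2)"

definition hyperbolic_metric :: "('p, 'e::euclidean_space) chart set \<Rightarrow> ('p, 'e) tensor2 \<Rightarrow> bool" where
  "hyperbolic_metric A h \<longleftrightarrow>
     riemannian_metric A h \<and>
     (\<exists>\<kappa><0. \<forall>c\<in>A. \<forall>x\<in>chart_range c. \<forall>u v.
        u \<noteq> v \<and> independent {u, v} \<longrightarrow> sectional_curvature (h c) x u v = \<kappa>) \<and>
     (\<forall>c\<in>A. \<forall>x\<in>chart_range c. scalar_curvature (h c) x = - 1)"

definition minimal_hyperbolic_germ ::
  "('p, real^2) chart set \<Rightarrow> ('p, real^2) tensor2 \<Rightarrow> ('p, real^2) tensor2 \<Rightarrow> bool" where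
  "minimal_hyperbolic_germ A g m \<longleftrightarrow>
     riemannian_metric A g \<and> smooth_tensor2 A m \<and> symmetric_tensor2 A m \<and>
     (\<forall>c\<in>A. \<forall>x\<in>chart_range c.
        (\<forall>w u v. cov_deriv (g c) (m c) x w u v - cov_deriv (g c) (m c) x u w v = 0) \<and>
        scalar_curvature (g c) x + tensor_norm_sq (g c) (m c) x + 1 / 3 = 0 \<and>
        metric_trace (g c) (m c) x = 0)"

section \<open>Fundamental forms of the slice at height 0\<close>

definition first_ff :: "('e::euclidean_space \<times> real) bform_field \<Rightarrow> 'e bform_field" where
  "first_ff h x u v = h (x, 0) (u, 0) (v, 0)"

definition unit_normal :: "('e::euclidean_space \<times> real) bform_field \<Rightarrow> 'e \<Rightarrow> 'e \<times> real" where
  "unit_normal h x =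
     (THE \<nu>. (\<forall>u. h (x, 0) \<nu> (u, 0) = 0) \<and> h (x, 0) \<nu> \<nu> = 1 \<and> snd \<nu> > 0)"

text \<open>
  $-h(\nabla_u v, \nu) = h(\nabla_u \nu, v)$ with \<open>\<nu>\<close> pointing to increasing \<open>t\<close>. The sign is the one for
  which $\gamma(t) + dt^2$ has second fundamental form $\frac12\partial_t\gamma|_{t=0}$; see the
  lemma \<open>second_ff_gaussian\<close> below.
\<close>

definition second_ff :: "('e::euclidean_space \<times> real) bform_field \<Rightarrow> 'e bform_field" where
  "second_ff h x u v = - h (x, 0) (christoffel h (x, 0) (u, 0) (v, 0)) (unit_normal h x)"

lemma sharp_eq:
  fixes g :: "'e::euclidean_space bform_field"
  assumes bil: "bilinear (g x)" and pos: "\<And>u. u \<noteq> 0 \<Longrightarrow> g x u u > 0" and \<alpha>: "linear \<alpha>"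
  shows "g x (sharp g x \<alpha>) z = \<alpha> z"
proof -
  define F where "F w = (\<Sum>b\<in>Basis. g x w b *\<^sub>R b)" for w
  have linr: "linear (g x w)" for w
    using bil by (auto simp: bilinear_def)
  have linF: "linear F"
    by (rule linearI) (simp_all add: F_def bilinear_ladd[OF bil] bilinear_lmul[OF bil]
        scaleR_left_distrib sum.distrib scaleR_sum_right)
  have F_inner: "F w \<bullet> z = g x w z" for w z
  proof -
    have "g x w z = g x w (\<Sum>b\<in>Basis. (z \<bullet> b) *\<^sub>R b)" by (simp add: euclidean_representation)
    also have "\<dots> = (\<Sum>b\<in>Basis. (z \<bullet> b) * g x w b)"
      using linr[of w] by (simp add: linear_sum linear_cmul o_def)
    finally show ?thesis by (simp add: F_def inner_sum_left inner_sum_right inner_commute mult.commute)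
  qed
  have "inj F"
    unfolding linear_injective_0[OF linF]
  proof (intro allI impI)
    fix w assume "F w = 0"
    then have "g x w w = 0" using F_inner[of w w] by simp
    then show "w = 0" using pos[of w] by force
  qed
  then have "surj F" using linF linear_injective_imp_surjective by blast
  then obtain w where w: "F w = (\<Sum>b\<in>Basis. \<alpha> b *\<^sub>R b)" by (metis surjD)
  have w_dual: "g x w z = \<alpha> z" for z
  proof -
    have "\<alpha> z = \<alpha> (\<Sum>b\<in>Basis. (z \<bullet> b) *\<^sub>R b)" by (simp add: euclidean_representation)
    also have "\<dots> = (\<Sum>b\<in>Basis. (z \<bullet> b) * \<alpha> b)"
      using \<alpha> by (simp add: linear_sum linear_cmul o_def)
    finally show ?thesis
      unfolding F_inner[symmetric] w by (simp add: inner_sum_left inner_sum_right inner_commute mult.commute)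
  qed
  have "sharp g x \<alpha> = w"
    unfolding sharp_def
  proof (rule the_equality)
    show "\<forall>z. g x w z = \<alpha> z" using w_dual by blast
  next
    fix w' assume "\<forall>z. g x w' z = \<alpha> z"
    then have "F w' = F w" unfolding F_def w_dual by presburger
    then show "w' = w" using \<open>inj F\<close> by (simp add: inj_eq)
  qed
  then show ?thesis using w_dual by blast
qed

lemma christoffel_eq:
  fixes g :: "'e::euclidean_space bform_field"
  assumes bil: "\<And>y. bilinear (g y)" and pos: "\<And>u. u \<noteq> 0 \<Longrightarrow> g x u u > 0"
    and diff: "\<And>u v. (\<lambda>y. g y u v) differentiable (at x)"
  shows "g x (christoffel g x u v) z =
     (frechet_derivative (\<lambda>y. g y v z) (at x) u
      + frechet_derivative (\<lambda>y. g y u z) (at x) v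
      - frechet_derivative (\<lambda>y. g y u v) (at x) z) / 2"
proof -
  have D: "((\<lambda>y. g y p q) has_derivative frechet_derivative (\<lambda>y. g y p q) (at x)) (at x)" for p q
    using diff frechet_derivative_works by blast
  have lin: "linear (\<lambda>z. frechet_derivative (\<lambda>y. g y p z) (at x) q)" for p q
  proof (rule linearI)
    fix a b
    have "((\<lambda>y. g y p (a + b)) has_derivative
        (\<lambda>q. frechet_derivative (\<lambda>y. g y p a) (at x) q + frechet_derivative (\<lambda>y. g y p b) (at x) q)) (at x)"
      by (simp add: bilinear_radd[OF bil] has_derivative_add D)
    from frechet_derivative_at[OF this]
    show "frechet_derivative (\<lambda>y. g y p (a + b)) (at x) q =
       frechet_derivative (\<lambda>y. g y p a) (at x) q + frechet_derivative (\<lambda>y. g y p b) (at x) q"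
      by metis
  next
    fix r a
    have "((\<lambda>y. g y p (r *\<^sub>R a)) has_derivative
        (\<lambda>q. r *\<^sub>R frechet_derivative (\<lambda>y. g y p a) (at x) q)) (at x)"
      unfolding bilinear_rmul[OF bil] by (intro has_derivative_scaleR_right D)
    from frechet_derivative_at[OF this]
    show "frechet_derivative (\<lambda>y. g y p (r *\<^sub>R a)) (at x) q =
       r *\<^sub>R frechet_derivative (\<lambda>y. g y p a) (at x) q"
      by metis
  qed
  have "linear (\<lambda>z. (1/2) *\<^sub>R (frechet_derivative (\<lambda>y. g y v z) (at x) u
      + frechet_derivative (\<lambda>y. g y u z) (at x) v
      - frechet_derivative (\<lambda>y. g y u v) (at x) z))"
    by (intro linear_compose_scale_right linear_compose_sub linear_compose_add lin
        linear_frechet_derivative diff)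
  then show ?thesis
    unfolding christoffel_def by (intro sharp_eq bil pos) simp_all
qed

lemma second_ff_gaussian:
  fixes \<gamma> :: "real \<Rightarrow> 'e::euclidean_space bform_field"
  defines "h \<equiv> \<lambda>y u v. \<gamma> (snd y) (fst y) (fst u) (fst v) + snd u * snd v"
  assumes bil: "\<And>t y. bilinear (\<gamma> t y)"
    and pos: "\<And>u. u \<noteq> 0 \<Longrightarrow> \<gamma> 0 x u u > 0"
    and diff: "\<And>u v. (\<lambda>y. \<gamma> (snd y) (fst y) u v) differentiable (at (x, 0))"
  shows "second_ff h x u v = deriv (\<lambda>t. \<gamma> t x u v) 0 / 2"
proof -
  have bilh: "bilinear (h y)" for y
    unfolding bilinear_def h_def
    by (auto intro!: linearI simp: bilinear_radd[OF bil] bilinear_ladd[OF bil]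
        bilinear_rmul[OF bil] bilinear_lmul[OF bil] algebra_simps)
  have posh: "h (x, 0) p p > 0" if "p \<noteq> 0" for p
  proof (cases "fst p = 0")
    case True
    then have "snd p \<noteq> 0" using that by (simp add: prod_eq_iff)
    then show ?thesis using True by (simp add: h_def bilinear_lzero[OF bil] not_sum_power2_lt_zero
          zero_less_mult_iff linorder_neq_iff disj_commute)
  next
    case False
    then show ?thesis using pos[of "fst p"] by (simp add: h_def add_pos_nonneg)
  qed
  have diffh: "(\<lambda>y. h y p q) differentiable (at (x, 0))" for p q
    unfolding h_def by (intro derivative_intros diff)
  have "unit_normal h x = (0, 1)"
    unfolding unit_normal_def
  proof (rule the_equality)
    show "(\<forall>u. h (x, 0) (0, 1) (u, 0) = 0) \<and> h (x, 0) (0, 1) (0, 1) = 1 \<and> snd (0::'e, 1::real) > 0"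
      by (simp add: h_def bilinear_lzero[OF bil])
  next
    fix \<nu> assume \<nu>: "(\<forall>u. h (x, 0) \<nu> (u, 0) = 0) \<and> h (x, 0) \<nu> \<nu> = 1 \<and> snd \<nu> > 0"
    then have "\<gamma> 0 x (fst \<nu>) (fst \<nu>) = 0" by (auto simp: h_def)
    then have 0: "fst \<nu> = 0" using pos[of "fst \<nu>"] by force
    then have "snd \<nu> * snd \<nu> = 1" using \<nu> by (simp add: h_def bilinear_lzero[OF bil])
    then have "snd \<nu> = 1" using \<nu>
      by (metis abs_of_pos abs_square_eq_1 power2_eq_square)
    then show "\<nu> = (0, 1)" using 0 by (simp add: prod_eq_iff)
  qed
  moreover have "frechet_derivative (\<lambda>y. h y (p, 0) (0, 1)) (at (x, 0)) q = 0" for p q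
    by (simp add: h_def bilinear_rzero[OF bil])
  ultimately have sff: "second_ff h x u v =
      frechet_derivative (\<lambda>y. h y (u, 0) (v, 0)) (at (x, 0)) (0, 1) / 2"
    unfolding second_ff_def by (simp add: christoffel_eq[OF bilh posh diffh])
  define L where "L = frechet_derivative (\<lambda>y. h y (u, 0) (v, 0)) (at (x, 0))"
  have L: "((\<lambda>y. h y (u, 0) (v, 0)) has_derivative L) (at (x, 0))"
    unfolding L_def using diffh frechet_derivative_works by blast
  have P: "((\<lambda>t. (x, t)) has_derivative (\<lambda>t. (0, t))) (at (0::real))"
    by (auto intro!: derivative_eq_intros)
  have "((\<lambda>t. h (x, t) (u, 0) (v, 0)) has_derivative (\<lambda>t. L (0, t))) (at 0)"
    using has_derivative_compose[OF P] L by blast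
  moreover have "(\<lambda>t. L (0, t)) = (*) (L (0, 1))"
  proof
    fix t
    have "L (t *\<^sub>R (0, 1)) = t *\<^sub>R L (0, 1)"
      using L by (meson has_derivative_linear linear_cmul)
    then show "L (0, t) = L (0, 1) * t" by (simp add: mult.commute)
  qed
  ultimately have "((\<lambda>t. \<gamma> t x u v) has_field_derivative L (0, 1)) (at 0)"
    by (simp add: has_field_derivative_def h_def)
  then have "deriv (\<lambda>t. \<gamma> t x u v) 0 = L (0, 1)" by (rule DERIV_imp_deriv)
  then show ?thesis using sff by (simp add: L_def)
qed

end

theory Submission
  imports Defs
begin

text \<open>
  The metric can be written down. Let \<open>S\<close> be the shape operator, \<open>g(Su, v) = m(u, v)\<close>. If the
  hyperbolic metric is sought in the Gaussian form \<open>\<gamma>(t) + dt\<^sup>2\<close>, then the Jacobi equation along the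
  normal geodesics leaves no choice but \<open>\<gamma>(t) = g(B\<cdot>, B\<cdot>)\<close> with
  \<open>B = cosh(t/\<surd>6) + \<surd>6 sinh(t/\<surd>6) S\<close>. As \<open>S\<close> is symmetric and traceless on a plane,
  \<open>S\<^sup>2 = |m|\<^sup>2 / 2\<close>, so \<open>\<gamma>\<close> is a combination of \<open>g\<close> and \<open>m\<close> with coefficients depending on \<open>t\<close> and
  the function \<open>|m|\<^sup>2\<close>. It is therefore a globally defined smooth tensor field, positive definite on
  the open set \<open>W\<close> where \<open>det B > 0\<close>, which contains the slice \<open>t = 0\<close>.

  To compute the curvature, transport the tangent bundle of the cylinder to \<open>T\<Sigma> \<oplus> \<real>\<close> by
  \<open>(u, a) \<mapsto> (Bu, a)\<close>; this is an isometry onto the metric \<open>g + dt\<^sup>2\<close>, which does not depend on \<open>t\<close>.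
  On that bundle the connection \<open>\<nabla>\<^sub>X(w, q) = (\<nabla>\<^sub>X w + q B'u, X(q) - g(B'u, w))\<close>, for \<open>X = (u, a)\<close>, is metric,
  and its torsion vanishes because \<open>B\<close> satisfies the Codazzi equation and \<open>B'B\<close> is symmetric, so it is
  the Levi-Civita connection (lemmas \<open>frame_christoffel\<close>, \<open>christoffel_h\<close>). Its curvature is computed in
  \<open>conn_curvature\<close> from the Codazzi equation for \<open>B'\<close>, the equation \<open>B'' = B/6\<close>, and the Gauss equation
  \<open>R(u,v) - B'u \<and> B'v = -(1/6) Bu \<and> Bv\<close> (lemma \<open>gauss_wedge\<close>), in which the hypothesis on the scalar
  curvature of \<open>g\<close> enters. The result is constant sectional curvature \<open>-1/6\<close>.
\<close>

section \<open>Calculus of finite order of differentiability\<close>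

lemma Ck_on_SucI:
  assumes "\<And>x. x \<in> S \<Longrightarrow> (f has_derivative f' x) (at x)"
    and "\<And>v. Ck_on k S (\<lambda>x. frechet_derivative f (at x) v)"
  shows "Ck_on (Suc k) S f"
  using assms by (auto simp: differentiable_def)

lemma Ck_on_Suc_derivative:
  assumes "Ck_on (Suc k) S f" "x \<in> S"
  shows "(f has_derivative frechet_derivative f (at x)) (at x)"
  using assms by (auto simp: frechet_derivative_works[symmetric])

lemma Ck_on_cong:
  assumes "open S" "\<And>x. x \<in> S \<Longrightarrow> f x = g x" "Ck_on k S f"
  shows "Ck_on k S g"
  using assms(2,3)
proof (induction k arbitrary: f g)
  case 0
  then show ?case by (simp cong: continuous_on_cong)
next
  case (Suc k)
  have d: "f differentiable (at x)" if "x \<in> S" for x using Suc that by auto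
  have dg: "g differentiable (at x)" if "x \<in> S" for x
    using d[OF that] Suc.prems(1) \<open>open S\<close> that
    by (meson differentiable_def has_derivative_transform_within_open)
  have eq: "frechet_derivative f (at x) = frechet_derivative g (at x)" if "x \<in> S" for x
    by (rule frechet_derivative_transform_within_open[OF d[OF that] \<open>open S\<close> that Suc.prems(1)])
  have "Ck_on k S (\<lambda>x. frechet_derivative g (at x) v)" for v
    by (rule Suc.IH[of "\<lambda>x. frechet_derivative f (at x) v"]) (use Suc.prems eq in auto)
  then show ?case using dg by simp
qed

text \<open>
  To raise the order it suffices to know the derivative on the open set itself: off that set the
  Frechet derivative is unspecified, and the congruence lemma makes this harmless.
\<close>

lemma Ck_on_Suc:
  assumes "open S" "\<And>x. x \<in> S \<Longrightarrow> (f has_derivative f' x) (at x)" "\<And>v. Ck_on k S (\<lambda>x. f' x v)"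
  shows "Ck_on (Suc k) S f"
proof (rule Ck_on_SucI[OF assms(2)])
  fix v
  show "Ck_on k S (\<lambda>x. frechet_derivative f (at x) v)"
    by (rule Ck_on_cong[OF assms(1) _ assms(3)[of v]]) (metis assms(2) frechet_derivative_at)
qed

lemma Ck_on_SucD: "Ck_on (Suc k) S f \<Longrightarrow> Ck_on k S f"
proof (induction k arbitrary: f)
  case 0
  then show ?case by (auto intro!: continuous_at_imp_continuous_on differentiable_imp_continuous_within)
next
  case (Suc k)
  then show ?case by (metis Ck_on.simps(2))
qed

lemma Ck_on_const: "Ck_on k S (\<lambda>x. c)"
  by (induction k arbitrary: c) auto

lemma Ck_on_add:
  assumes "open S"
  shows "Ck_on k S f \<Longrightarrow> Ck_on k S g \<Longrightarrow> Ck_on k S (\<lambda>x. f x + g x)"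
proof (induction k arbitrary: f g)
  case 0
  then show ?case by (auto intro: continuous_intros)
next
  case (Suc k)
  show ?case
    by (rule Ck_on_Suc[OF assms, where f' = "\<lambda>x v. frechet_derivative f (at x) v + frechet_derivative g (at x) v"])
      (use Suc.prems in \<open>auto intro!: has_derivative_add Ck_on_Suc_derivative Suc.IH simp del: Ck_on.simps(2)\<close>, simp_all)
qed

lemma Ck_on_bilinear:
  assumes "open S" "bounded_bilinear pr"
  shows "Ck_on k S f \<Longrightarrow> Ck_on k S g \<Longrightarrow> Ck_on k S (\<lambda>x. pr (f x) (g x))"
proof (induction k arbitrary: f g)
  case 0
  then show ?case by (auto intro: bounded_bilinear.continuous_on[OF assms(2)])
next
  case (Suc k)
  show ?case
  proof (rule Ck_on_Suc[OF assms(1), where f' = "\<lambda>x v. pr (f x) (frechet_derivative g (at x) v)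
      + pr (frechet_derivative f (at x) v) (g x)"])
    fix x assume "x \<in> S"
    then show "((\<lambda>x. pr (f x) (g x)) has_derivative (\<lambda>v. pr (f x) (frechet_derivative g (at x) v)
      + pr (frechet_derivative f (at x) v) (g x))) (at x)"
      using Suc.prems by (intro bounded_bilinear.FDERIV[OF assms(2)] Ck_on_Suc_derivative)
  next
    fix v
    have "Ck_on k S (\<lambda>x. frechet_derivative f (at x) v)" "Ck_on k S (\<lambda>x. frechet_derivative g (at x) v)"
      using Suc.prems by simp_all
    then show "Ck_on k S (\<lambda>x. pr (f x) (frechet_derivative g (at x) v) + pr (frechet_derivative f (at x) v) (g x))"
      by (intro Ck_on_add assms(1) Suc.IH Suc.prems[THEN Ck_on_SucD])
  qed
qed

lemmas Ck_on_mult = Ck_on_bilinear[OF _ bounded_bilinear_mult]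
lemmas Ck_on_scaleR = Ck_on_bilinear[OF _ bounded_bilinear_scaleR]

lemma Ck_on_diff:
  fixes f g :: "'a::real_normed_vector \<Rightarrow> 'b::real_normed_vector"
  assumes "open S" "Ck_on k S f" "Ck_on k S g" shows "Ck_on k S (\<lambda>x. f x - g x)"
  using Ck_on_add[OF assms(1,2) Ck_on_scaleR[OF assms(1) Ck_on_const[of k S "-1"] assms(3)]] by simp

lemma Ck_on_sum:
  assumes "open S" "finite I" "\<And>i. i \<in> I \<Longrightarrow> Ck_on k S (f i)"
  shows "Ck_on k S (\<lambda>x. \<Sum>i\<in>I. f i x)"
  using assms(2,3) by (induction I rule: finite_induct) (auto intro: Ck_on_const Ck_on_add[OF assms(1)])

lemma Ck_on_inverse:
  fixes f :: "'a::real_normed_vector \<Rightarrow> real"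
  assumes "open S" "\<And>x. x \<in> S \<Longrightarrow> f x \<noteq> 0" "Ck_on k S f"
  shows "Ck_on k S (\<lambda>x. inverse (f x))"
  using assms(3)
proof (induction k)
  case 0
  then show ?case using assms by (auto intro!: continuous_intros)
next
  case (Suc k)
  show ?case
  proof (rule Ck_on_Suc[OF assms(1), where f' = "\<lambda>x v. - (inverse (f x) * frechet_derivative f (at x) v * inverse (f x))"])
    fix x assume "x \<in> S"
    then show "((\<lambda>x. inverse (f x)) has_derivative
        (\<lambda>v. - (inverse (f x) * frechet_derivative f (at x) v * inverse (f x)))) (at x)"
      using Suc.prems assms(2) by (intro Deriv.has_derivative_inverse Ck_on_Suc_derivative)
  next
    fix v
    have "Ck_on k S (\<lambda>x. 0 - inverse (f x) * frechet_derivative f (at x) v * inverse (f x))"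
      using Suc.IH[OF Ck_on_SucD[OF Suc.prems]] Suc.prems
      by (intro Ck_on_diff Ck_on_const Ck_on_mult assms(1)) simp_all
    then show "Ck_on k S (\<lambda>x. - (inverse (f x) * frechet_derivative f (at x) v * inverse (f x)))" by simp
  qed
qed

lemma Ck_on_compose_linear:
  assumes "open U" "bounded_linear L" "\<And>p. p \<in> U \<Longrightarrow> L p \<in> S" "Ck_on k S f"
  shows "Ck_on k U (\<lambda>p. f (L p))"
  using assms(4)
proof (induction k arbitrary: f)
  case 0
  then have "continuous_on S f" by simp
  moreover have "continuous_on U L"
    using assms(2) by (simp add: linear_continuous_on)
  ultimately show ?case using assms(3) by (auto intro: continuous_on_compose2)
next
  case (Suc k)
  show ?case
  proof (rule Ck_on_Suc[OF assms(1), where f' = "\<lambda>p v. frechet_derivative f (at (L p)) (L v)"])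
    fix p assume "p \<in> U"
    then have "(f has_derivative frechet_derivative f (at (L p))) (at (L p))"
      using Suc.prems assms(3) by (intro Ck_on_Suc_derivative)
    from has_derivative_compose[OF bounded_linear_imp_has_derivative[OF assms(2)] this]
    show "((\<lambda>p. f (L p)) has_derivative (\<lambda>v. frechet_derivative f (at (L p)) (L v))) (at p)" .
  next
    fix v
    show "Ck_on k U (\<lambda>p. frechet_derivative f (at (L p)) (L v))"
      using Suc.prems by (intro Suc.IH) simp
  qed
qed

lemma Ck_on_exp: "open S \<Longrightarrow> Ck_on k S (\<lambda>t::real. c * exp (a * t))"
proof (induction k arbitrary: c)
  case 0
  then show ?case by (auto intro!: continuous_intros)
next
  case (Suc k)
  show ?case
    by (rule Ck_on_Suc[OF Suc.prems, where f' = "\<lambda>x v. (c * a * v) * exp (a * x)"])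
      (use Suc in \<open>auto intro!: derivative_eq_intros\<close>)
qed

text \<open>
  The double difference of \<open>f\<close> along \<open>u\<close> and \<open>v\<close> is symmetric in the two vectors. The mean value
  theorem in the direction \<open>v\<close> turns it into a difference of values of the directional derivative
  along \<open>v\<close> at two points that are \<open>s u\<close> apart, and differentiability of that derivative at the
  single point \<open>x\<close> gives the limit.
\<close>

lemma second_difference_quotient:
  fixes f :: "'a::real_normed_vector \<Rightarrow> real"
  assumes "open S" "x \<in> S"
    and f: "\<And>y. y \<in> S \<Longrightarrow> (f has_derivative f' y) (at y)"
    and f2: "((\<lambda>y. f' y v) has_derivative L) (at x)"
  shows "((\<lambda>s. (f (x + s *\<^sub>R u + s *\<^sub>R v) - f (x + s *\<^sub>R u) - f (x + s *\<^sub>R v) + f x) / s\<^sup>2)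
            \<longlongrightarrow> L u) (at_right 0)"
proof -
  define M where "M = norm u + norm v + 1"
  have M: "M > 0" "norm u \<le> M" "norm v \<le> M" "norm u + norm v \<le> M" by (auto simp: M_def add_nonneg_pos)
  obtain r where r: "r > 0" "ball x r \<subseteq> S" using assms(1,2) openE by blast
  interpret L: bounded_linear L using f2 by (rule has_derivative_bounded_linear)
  show ?thesis
  proof (rule tendstoI)
    fix e :: real assume "e > 0"
    define e' where "e' = e / (4 * M)"
    have "e' > 0" using \<open>e > 0\<close> M by (simp add: e'_def)
    then obtain d where d: "d > 0" and dd: "\<And>y. norm (y - x) < d \<Longrightarrow> \<bar>f' y v - f' x v - L (y - x)\<bar> \<le> e' * norm (y - x)"
      using f2 unfolding has_derivative_at_alt by (auto simp: real_norm_def)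
    define \<delta> where "\<delta> = min d r / (M)"
    have \<delta>: "\<delta> > 0" using d r M by (simp add: \<delta>_def)
    have main: "\<bar>(f (x + s *\<^sub>R u + s *\<^sub>R v) - f (x + s *\<^sub>R u) - f (x + s *\<^sub>R v) + f x) / s\<^sup>2 - L u\<bar> < e"
      if s: "0 < s" "s < \<delta>" for s
    proof -
      have sM: "s * M < d" "s * M < r" using s M by (auto simp: \<delta>_def field_simps)
      define a where "a = (\<lambda>\<tau>. x + s *\<^sub>R u + (\<tau> * s) *\<^sub>R v)"
      define b where "b = (\<lambda>\<tau>. x + (\<tau> * s) *\<^sub>R v)"
      have na: "norm (a \<tau> - x) \<le> s * M" "norm (b \<tau> - x) \<le> s * M" if "0 \<le> \<tau>" "\<tau> \<le> 1" for \<tau>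
      proof -
        have t: "norm ((\<tau> * s) *\<^sub>R v) \<le> s * norm v" using that s by (simp add: mult_left_le_one_le mult_right_mono)
        have "norm (a \<tau> - x) \<le> norm (s *\<^sub>R u) + norm ((\<tau> * s) *\<^sub>R v)"
          using norm_triangle_ineq[of "s *\<^sub>R u"] by (simp add: a_def add.assoc del: norm_scaleR)
        also have "\<dots> \<le> s * (norm u + norm v)" using t s by (simp add: algebra_simps)
        also have "\<dots> \<le> s * M" using M s by (intro mult_left_mono) auto
        finally show "norm (a \<tau> - x) \<le> s * M" .
        have "s * norm v \<le> s * M" using M s by (intro mult_left_mono) auto
        then show "norm (b \<tau> - x) \<le> s * M" using t by (simp add: b_def)
      qed
      have inS: "a \<tau> \<in> S" "b \<tau> \<in> S" if "0 \<le> \<tau>" "\<tau> \<le> 1" for \<tau>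
        using na[OF that] sM r(2) by (auto simp: subset_iff dist_norm norm_minus_commute)
      define \<phi> where "\<phi> = (\<lambda>\<tau>. f (a \<tau>) - f (b \<tau>))"
      have d\<phi>: "(\<phi> has_real_derivative s * (f' (a \<tau>) v - f' (b \<tau>) v)) (at \<tau>)" if t: "0 \<le> \<tau>" "\<tau> \<le> 1" for \<tau>
      proof -
        have 1: "(a has_derivative (\<lambda>h. (h * s) *\<^sub>R v)) (at \<tau>)" "(b has_derivative (\<lambda>h. (h * s) *\<^sub>R v)) (at \<tau>)"
          unfolding a_def b_def by (auto intro!: derivative_eq_intros)
        have lin: "linear (f' (a \<tau>))" "linear (f' (b \<tau>))" using f inS[OF t] has_derivative_linear by blast+
        have "(\<phi> has_derivative (\<lambda>h. f' (a \<tau>) ((h * s) *\<^sub>R v) - f' (b \<tau>) ((h * s) *\<^sub>R v))) (at \<tau>)"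
          unfolding \<phi>_def
          by (intro has_derivative_diff has_derivative_compose[OF 1(1) f] has_derivative_compose[OF 1(2) f] inS t)
        moreover have "(\<lambda>h. f' (a \<tau>) ((h * s) *\<^sub>R v) - f' (b \<tau>) ((h * s) *\<^sub>R v)) = (*) (s * (f' (a \<tau>) v - f' (b \<tau>) v))"
          by (auto simp: linear_cmul[OF lin(1)] linear_cmul[OF lin(2)] algebra_simps)
        ultimately show ?thesis by (simp add: has_field_derivative_def)
      qed
      obtain \<tau> where \<tau>: "0 < \<tau>" "\<tau> < 1" and mv: "\<phi> 1 - \<phi> 0 = s * (f' (a \<tau>) v - f' (b \<tau>) v)"
        using MVT2[of 0 1 \<phi> "\<lambda>\<tau>. s * (f' (a \<tau>) v - f' (b \<tau>) v)"] d\<phi> by auto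
      have "\<bar>f' (a \<tau>) v - f' x v - L (a \<tau> - x)\<bar> \<le> e' * (s * M)"
        using dd[of "a \<tau>"] na(1)[of \<tau>] \<tau> sM \<open>e' > 0\<close> by (smt (verit) mult_left_mono)
      moreover have "\<bar>f' (b \<tau>) v - f' x v - L (b \<tau> - x)\<bar> \<le> e' * (s * M)"
        using dd[of "b \<tau>"] na(2)[of \<tau>] \<tau> sM \<open>e' > 0\<close> by (smt (verit) mult_left_mono)
      moreover have "L (a \<tau> - x) - L (b \<tau> - x) = s * L u"
        by (simp add: a_def b_def L.add L.diff L.scaleR)
      ultimately have "\<bar>f' (a \<tau>) v - f' (b \<tau>) v - s * L u\<bar> \<le> 2 * (e' * (s * M))"
        by linarith
      then have "\<bar>f' (a \<tau>) v - f' (b \<tau>) v - s * L u\<bar> \<le> s * (e / 2)"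
        using M by (simp add: e'_def field_simps)
      then have "\<bar>(f' (a \<tau>) v - f' (b \<tau>) v - s * L u) / s\<bar> \<le> e / 2"
        using s by (simp add: abs_divide divide_le_eq mult.commute)
      moreover have "(f (x + s *\<^sub>R u + s *\<^sub>R v) - f (x + s *\<^sub>R u) - f (x + s *\<^sub>R v) + f x) / s\<^sup>2 - L u
          = (f' (a \<tau>) v - f' (b \<tau>) v - s * L u) / s"
      proof -
        have "f (x + s *\<^sub>R u + s *\<^sub>R v) - f (x + s *\<^sub>R u) - f (x + s *\<^sub>R v) + f x = \<phi> 1 - \<phi> 0"
          by (simp add: \<phi>_def a_def b_def)
        then have "f (x + s *\<^sub>R u + s *\<^sub>R v) - f (x + s *\<^sub>R u) - f (x + s *\<^sub>R v) + f x
            = s * (f' (a \<tau>) v - f' (b \<tau>) v)" using mv by simp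
        then show ?thesis using s by (simp only:) (simp add: diff_divide_distrib power2_eq_square)
      qed
      moreover have "e / 2 < e" using \<open>e > 0\<close> by simp
      ultimately show ?thesis by (metis le_less_trans)
    qed
    show "\<forall>\<^sub>F s in at_right 0. dist ((f (x + s *\<^sub>R u + s *\<^sub>R v) - f (x + s *\<^sub>R u) - f (x + s *\<^sub>R v) + f x) / s\<^sup>2) (L u) < e"
      unfolding eventually_at_right_field dist_real_def using main \<delta> by blast
  qed
qed

lemma second_derivative_symmetric:
  fixes f :: "'a::real_normed_vector \<Rightarrow> 'b::euclidean_space"
  assumes "open S" "x \<in> S"
    and f: "\<And>y. y \<in> S \<Longrightarrow> (f has_derivative f' y) (at y)"
    and f2: "\<And>v. ((\<lambda>y. f' y v) has_derivative (\<lambda>u. f'' u v)) (at x)"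
  shows "f'' u v = f'' v u"
proof (rule euclidean_eqI)
  fix i :: 'b
  have *: "((\<lambda>s. (f (x + s *\<^sub>R u + s *\<^sub>R v) \<bullet> i - f (x + s *\<^sub>R u) \<bullet> i - f (x + s *\<^sub>R v) \<bullet> i + f x \<bullet> i) / s\<^sup>2)
            \<longlongrightarrow> f'' u v \<bullet> i) (at_right 0)" for u v
    by (rule second_difference_quotient[OF assms(1,2), where f' = "\<lambda>y v. f' y v \<bullet> i"])
      (auto intro!: has_derivative_inner_left f f2)
  have comm: "x + s *\<^sub>R u + s *\<^sub>R v = x + s *\<^sub>R v + s *\<^sub>R u" for s
    by (simp only: ac_simps)
  have swap: "(a - b - c + d) / e = (a - c - b + d) / e" for a b c d e :: real
    by simp
  have "(\<lambda>s. (f (x + s *\<^sub>R u + s *\<^sub>R v) \<bullet> i - f (x + s *\<^sub>R u) \<bullet> i - f (x + s *\<^sub>R v) \<bullet> i + f x \<bullet> i) / s\<^sup>2)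
     = (\<lambda>s. (f (x + s *\<^sub>R v + s *\<^sub>R u) \<bullet> i - f (x + s *\<^sub>R v) \<bullet> i - f (x + s *\<^sub>R u) \<bullet> i + f x \<bullet> i) / s\<^sup>2)"
    by (intro ext, subst comm, rule swap)
  from *[of u v, unfolded this] *[of v u] show "f'' u v \<bullet> i = f'' v u \<bullet> i"
    by (rule tendsto_unique[OF trivial_limit_at_right_real])
qed

lemma linear_family_derivative_linear:
  assumes "open U" "x \<in> U" "\<And>y. y \<in> U \<Longrightarrow> linear (L y)"
    and "\<And>p. ((\<lambda>y. L y p) has_derivative (\<lambda>d. L' d p)) (at x)"
  shows "linear (L' d)"
proof (rule linearI)
  fix p q
  have "((\<lambda>y. L y (p + q)) has_derivative (\<lambda>d. L' d p + L' d q)) (at x)"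
    by (rule has_derivative_transform_within_open[OF has_derivative_add[OF assms(4) assms(4)] assms(1,2)])
      (simp add: linear_add[OF assms(3)])
  then show "L' d (p + q) = L' d p + L' d q"
    using has_derivative_unique[OF assms(4)[of "p + q"]] by metis
next
  fix r p
  have "((\<lambda>y. L y (r *\<^sub>R p)) has_derivative (\<lambda>d. r *\<^sub>R L' d p)) (at x)"
    by (rule has_derivative_transform_within_open[OF has_derivative_scaleR_right[OF assms(4)] assms(1,2)])
      (simp add: linear_cmul[OF assms(3)])
  then show "L' d (r *\<^sub>R p) = r *\<^sub>R L' d p"
    using has_derivative_unique[OF assms(4)[of "r *\<^sub>R p"]] by metis
qed

lemma linear_expand:
  fixes L :: "'a::euclidean_space \<Rightarrow> 'b::real_vector"
  assumes "linear L" shows "L p = (\<Sum>i\<in>Basis. (p \<bullet> i) *\<^sub>R L i)"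
proof -
  have "L p = L (\<Sum>i\<in>Basis. (p \<bullet> i) *\<^sub>R i)" by (simp add: euclidean_representation)
  then show ?thesis using assms by (simp add: linear_sum linear_cmul o_def)
qed

text \<open>
  In coordinates the metric, the Christoffel symbols and the shape operator are families of linear
  maps depending on the base point, often applied to vectors that move with the base point. Since the
  space of arguments is finite dimensional, differentiability for each fixed argument is enough for
  the product rule.
\<close>

lemma has_derivative_linear_family:
  fixes L :: "'a::real_normed_vector \<Rightarrow> 'b::euclidean_space \<Rightarrow> 'c::real_normed_vector"
  assumes "open U" "x \<in> U" "\<And>y. y \<in> U \<Longrightarrow> linear (L y)"
    and L': "\<And>p. ((\<lambda>y. L y p) has_derivative (\<lambda>d. L' d p)) (at x)"
    and q: "(q has_derivative q') (at x)"
  shows "((\<lambda>y. L y (q y)) has_derivative (\<lambda>d. L' d (q x) + L x (q' d))) (at x)"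
proof -
  have "((\<lambda>y. \<Sum>i\<in>Basis. (q y \<bullet> i) *\<^sub>R L y i) has_derivative
     (\<lambda>d. \<Sum>i\<in>Basis. (q x \<bullet> i) *\<^sub>R L' d i + (q' d \<bullet> i) *\<^sub>R L x i)) (at x)"
    by (intro has_derivative_sum has_derivative_scaleR has_derivative_inner_left L' q)
  moreover have "(\<lambda>d. \<Sum>i\<in>Basis. (q x \<bullet> i) *\<^sub>R L' d i + (q' d \<bullet> i) *\<^sub>R L x i) = (\<lambda>d. L' d (q x) + L x (q' d))"
    by (simp only: sum.distrib linear_expand[OF linear_family_derivative_linear[OF assms(1-3) L'], of _ "q x"]
        linear_expand[OF assms(3)[OF assms(2)], of "q' _"])
  ultimately have "((\<lambda>y. \<Sum>i\<in>Basis. (q y \<bullet> i) *\<^sub>R L y i) has_derivative (\<lambda>d. L' d (q x) + L x (q' d))) (at x)"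
    by simp
  then show ?thesis
    by (rule has_derivative_transform_within_open[OF _ assms(1,2)]) (rule linear_expand[OF assms(3), symmetric])
qed

lemma has_derivative_bilinear_family:
  fixes G :: "'a::real_normed_vector \<Rightarrow> 'b::euclidean_space \<Rightarrow> 'b \<Rightarrow> 'c::real_normed_vector"
  assumes "open U" "x \<in> U" "\<And>y. y \<in> U \<Longrightarrow> bilinear (G y)"
    and G': "\<And>p q. ((\<lambda>y. G y p q) has_derivative (\<lambda>d. G' d p q)) (at x)"
    and p: "(p has_derivative p') (at x)" and q: "(q has_derivative q') (at x)"
  shows "((\<lambda>y. G y (p y) (q y)) has_derivative (\<lambda>d. G' d (p x) (q x) + G x (p' d) (q x) + G x (p x) (q' d))) (at x)"
proof -
  have 1: "((\<lambda>y. G y (p y) c) has_derivative (\<lambda>d. G' d (p x) c + G x (p' d) c)) (at x)" for c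
    by (rule has_derivative_linear_family[OF assms(1,2), where L = "\<lambda>y p. G y p c"])
      (use assms(3) G' p in \<open>auto simp: bilinear_def\<close>)
  show ?thesis
    using has_derivative_linear_family[OF assms(1,2), where L = "\<lambda>y. G y (p y)", OF _ 1 q] assms(3)
    by (auto simp: bilinear_def)
qed

section \<open>Levi-Civita connections and moving frames\<close>

definition inner_form :: "('e::euclidean_space \<Rightarrow> 'e \<Rightarrow> real) \<Rightarrow> bool" where
  "inner_form b \<longleftrightarrow> bilinear b \<and> (\<forall>u v. b u v = b v u) \<and> (\<forall>u. u \<noteq> 0 \<longrightarrow> b u u > 0)"

lemma inner_form_bilinear: "inner_form b \<Longrightarrow> bilinear b"
  and inner_form_sym: "inner_form b \<Longrightarrow> b u v = b v u"
  and inner_form_pos: "inner_form b \<Longrightarrow> u \<noteq> 0 \<Longrightarrow> b u u > 0"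
  by (auto simp: inner_form_def)

lemma bilinear_linear: "bilinear b \<Longrightarrow> linear (b u)" "bilinear b \<Longrightarrow> linear (\<lambda>u. b u v)"
  by (auto simp: bilinear_def)

lemma inner_form_eqI:
  assumes "inner_form b" "\<And>z. b u z = b v z" shows "u = v"
proof (rule ccontr)
  assume "u \<noteq> v"
  then have "b (u - v) (u - v) > 0" using inner_form_pos[OF assms(1)] by simp
  moreover have "b (u - v) (u - v) = 0"
    using assms(2) by (simp add: bilinear_lsub[OF inner_form_bilinear[OF assms(1)]])
  ultimately show False by simp
qed

lemma inner_form_sharp:
  assumes "inner_form (g x)" "linear \<alpha>" shows "g x (sharp g x \<alpha>) z = \<alpha> z"
  using assms by (intro sharp_eq) (auto simp: inner_form_def)

lemma sharp_unique:
  assumes "inner_form (g x)" "\<And>z. g x w z = \<alpha> z" shows "sharp g x \<alpha> = w"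
  unfolding sharp_def using assms inner_form_eqI[OF assms(1)] by (intro the_equality) auto

lemma inner_form_pullback:
  fixes b :: "'e::euclidean_space \<Rightarrow> 'e \<Rightarrow> real" and L :: "'f::euclidean_space \<Rightarrow> 'e"
  assumes b: "inner_form b" and L: "linear L" "inj L"
  shows "inner_form (\<lambda>u v. b (L u) (L v))"
  unfolding inner_form_def
proof (intro conjI allI impI)
  note bil = inner_form_bilinear[OF b]
  show "bilinear (\<lambda>u v. b (L u) (L v))"
    unfolding bilinear_def
    by (auto intro!: linearI simp: linear_add[OF L(1)] linear_cmul[OF L(1)] bilinear_ladd[OF bil]
        bilinear_radd[OF bil] bilinear_lmul[OF bil] bilinear_rmul[OF bil])
  show "b (L u) (L v) = b (L v) (L u)" for u v by (rule inner_form_sym[OF b])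
  show "b (L u) (L u) > 0" if "u \<noteq> 0" for u
    using that L linear_injective_0 inner_form_pos[OF b] by blast
qed

text \<open>
  Bilinearity is available on an open set only, so linearity of the Koszul expression in each vector
  comes from uniqueness of the derivative of a family that is linear near \<open>x\<close>.
\<close>

lemma koszul_linear:
  fixes g :: "'e::euclidean_space bform_field"
  assumes "open U" "x \<in> U" and form: "\<And>y. y \<in> U \<Longrightarrow> inner_form (g y)"
    and diff: "\<And>u v. (\<lambda>y. g y u v) differentiable (at x)"
  shows "linear (\<lambda>p. frechet_derivative (\<lambda>y. g y p q) (at x) u)"
    and "linear (\<lambda>q. frechet_derivative (\<lambda>y. g y p q) (at x) u)"
    and "linear (\<lambda>z. (frechet_derivative (\<lambda>y. g y v z) (at x) u
      + frechet_derivative (\<lambda>y. g y u z) (at x) v - frechet_derivative (\<lambda>y. g y u v) (at x) z) / 2)"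
proof -
  let ?d = "\<lambda>p q. frechet_derivative (\<lambda>y. g y p q) (at x)"
  note bil = inner_form_bilinear[OF form]
  have D: "((\<lambda>y. g y p q) has_derivative ?d p q) (at x)" for p q
    using diff frechet_derivative_works by blast
  show "linear (\<lambda>p. ?d p q u)" for q u
    by (rule linear_family_derivative_linear[OF assms(1,2), where L = "\<lambda>y p. g y p q"])
      (auto intro: D bilinear_linear bil)
  show lin: "linear (\<lambda>q. ?d p q u)" for p u
    by (rule linear_family_derivative_linear[OF assms(1,2), where L = "\<lambda>y q. g y p q"])
      (auto intro: D bilinear_linear bil)
  have "linear (\<lambda>z. (1/2) *\<^sub>R (?d v z u + ?d u z v - ?d u v z))"
    by (intro linear_compose_scale_right linear_compose_sub linear_compose_add lin
        linear_frechet_derivative[OF diff])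
  then show "linear (\<lambda>z. (?d v z u + ?d u z v - ?d u v z) / 2)" by simp
qed

lemma levi_civita:
  fixes g :: "'e::euclidean_space bform_field"
  assumes "open U" "x \<in> U" and form: "\<And>y. y \<in> U \<Longrightarrow> inner_form (g y)"
    and diff: "\<And>u v. (\<lambda>y. g y u v) differentiable (at x)"
  shows "christoffel g x u v = christoffel g x v u"
    and "((\<lambda>y. g y v w) has_derivative (\<lambda>u. g x (christoffel g x u v) w + g x v (christoffel g x u w))) (at x)"
    and "bilinear (christoffel g x)"
proof -
  let ?d = "\<lambda>p q. frechet_derivative (\<lambda>y. g y p q) (at x)"
  note fx = form[OF assms(2)]
  note bil = inner_form_bilinear[OF form]
  have D: "((\<lambda>y. g y p q) has_derivative ?d p q) (at x)" for p q
    using diff frechet_derivative_works by blast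
  have sym: "?d p q = ?d q p" for p q
  proof -
    have "((\<lambda>y. g y p q) has_derivative ?d q p) (at x)"
      by (rule has_derivative_transform_within_open[OF D assms(1,2)]) (metis form inner_form_sym)
    then show ?thesis using D has_derivative_unique by blast
  qed
  note lin3 = linear_frechet_derivative[OF diff]
  note lin = koszul_linear[OF assms(1,2) form diff]
  have kos: "g x (christoffel g x u v) z = (?d v z u + ?d u z v - ?d u v z) / 2" for u v z
    unfolding christoffel_def by (rule inner_form_sharp[where g = g and x = x, OF fx lin(3)])
  show "christoffel g x u v = christoffel g x v u"
    by (rule inner_form_eqI[OF fx]) (simp add: kos sym[of v u])
  have "?d v w u = g x (christoffel g x u v) w + g x v (christoffel g x u w)" for u
    by (simp add: inner_form_sym[OF fx, of v] kos sym[of w v] sym[of u v] sym[of u w] field_simps)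
  then show "((\<lambda>y. g y v w) has_derivative (\<lambda>u. g x (christoffel g x u v) w + g x v (christoffel g x u w))) (at x)"
    using D[of v w] by presburger
  note ex = bilinear_ladd[OF inner_form_bilinear[OF fx]] bilinear_lmul[OF inner_form_bilinear[OF fx]]
  show "bilinear (christoffel g x)"
    unfolding bilinear_def
  proof (intro conjI allI linearI; rule inner_form_eqI[OF fx])
  qed (simp_all add: ex kos linear_add[OF lin(1)] linear_add[OF lin(2)] linear_add[OF lin3]
      linear_cmul[OF lin(1)] linear_cmul[OF lin(2)] linear_cmul[OF lin3] field_simps)
qed

text \<open>
  Differentiating \<open>\<partial>\<^sub>v g(w, z) = g(\<nabla>\<^sub>v w, z) + g(w, \<nabla>\<^sub>v z)\<close> once more along \<open>u\<close>, the left-hand side becomes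
  symmetric in \<open>u\<close> and \<open>v\<close>; its antisymmetric part is \<open>g(R(u,v)w, z) + g(w, R(u,v)z)\<close>.
\<close>

lemma riemann_skew:
  fixes g :: "'e::euclidean_space bform_field"
  assumes "open U" "x \<in> U" and form: "\<And>y. y \<in> U \<Longrightarrow> inner_form (g y)"
    and diff: "\<And>y u v. y \<in> U \<Longrightarrow> (\<lambda>y. g y u v) differentiable (at y)"
    and diff2: "\<And>u v. (\<lambda>y. christoffel g y u v) differentiable (at x)"
  shows "g x (riemann g x u v w) z = - g x w (riemann g x u v z)"
proof -
  let ?d = "\<lambda>v w u. frechet_derivative (\<lambda>y. christoffel g y v w) (at x) u"
  let ?\<Gamma> = "christoffel g x"
  note bil = inner_form_bilinear[OF form]
  have D: "((\<lambda>y. christoffel g y v w) has_derivative ?d v w) (at x)" for v w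
    using diff2 frechet_derivative_works by blast
  have lc: "((\<lambda>y. g y v w) has_derivative
      (\<lambda>u. g y (christoffel g y u v) w + g y v (christoffel g y u w))) (at y)" if "y \<in> U" for y v w
    using levi_civita(2)[OF assms(1) that form diff[OF that]] .
  let ?D2 = "\<lambda>u v. g x (?\<Gamma> u (?\<Gamma> v w)) z + g x (?\<Gamma> v w) (?\<Gamma> u z) + g x (?d v w u) z
     + (g x (?\<Gamma> u w) (?\<Gamma> v z) + g x w (?\<Gamma> u (?\<Gamma> v z)) + g x w (?d v z u))"
  have zero: "((\<lambda>y. c) has_derivative (\<lambda>d. 0)) (at x)" for c :: 'e by simp
  have "((\<lambda>y. g y (christoffel g y v w) z + g y w (christoffel g y v z)) has_derivative (\<lambda>u. ?D2 u v)) (at x)" for v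
    using has_derivative_add[OF has_derivative_bilinear_family[OF assms(1,2) bil lc[OF assms(2)] D[of v w] zero[of z]]
        has_derivative_bilinear_family[OF assms(1,2) bil lc[OF assms(2)] zero[of w] D[of v z]]]
    by (simp add: bilinear_rzero[OF bil[OF assms(2)]] bilinear_lzero[OF bil[OF assms(2)]])
  then have "?D2 u v = ?D2 v u"
    using second_derivative_symmetric[OF assms(1,2), where f = "\<lambda>y. g y w z" and f'' = ?D2
      and f' = "\<lambda>y v. g y (christoffel g y v w) z + g y w (christoffel g y v z)"] lc by blast
  then show ?thesis
    unfolding riemann_def
    by (simp add: bilinear_radd[OF bil[OF assms(2)]] bilinear_ladd[OF bil[OF assms(2)]]
        bilinear_rsub[OF bil[OF assms(2)]] bilinear_lsub[OF bil[OF assms(2)]])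
qed

text \<open>
  The Levi-Civita connection is determined by being metric and torsion free, and both properties may
  be tested after transporting the tangent spaces to another vector bundle by isomorphisms \<open>\<Phi>\<close>. If
  the connection \<open>d + \<omega>\<close> there preserves \<open>G\<close> and the form \<open>\<Phi>\<close> has no torsion for it, then \<open>\<Phi>\<close> carries
  the Levi-Civita connection of \<open>h = \<Phi>\<^sup>* G\<close> to \<open>d + \<omega>\<close>.
\<close>

lemma frame_christoffel:
  fixes h :: "'e::euclidean_space bform_field" and G :: "'e \<Rightarrow> 'f::euclidean_space \<Rightarrow> 'f \<Rightarrow> real"
  assumes "open U" "x \<in> U"
    and G: "\<And>y. y \<in> U \<Longrightarrow> inner_form (G y)"
    and \<Phi>: "linear (\<Phi> x)" "inj (\<Phi> x)"
    and h: "\<And>y u v. y \<in> U \<Longrightarrow> h y u v = G y (\<Phi> y u) (\<Phi> y v)"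
    and d\<Phi>: "\<And>v. ((\<lambda>y. \<Phi> y v) has_derivative (\<lambda>u. \<Phi>' u v)) (at x)"
    and compat: "\<And>p q. ((\<lambda>y. G y p q) has_derivative (\<lambda>u. G x (\<omega> u p) q + G x p (\<omega> u q))) (at x)"
    and torsion: "\<And>u v. \<Phi>' u v + \<omega> u (\<Phi> x v) = \<Phi>' v u + \<omega> v (\<Phi> x u)"
    and C: "\<Phi> x C = \<Phi>' u v + \<omega> u (\<Phi> x v)"
  shows "christoffel h x u v = C"
proof -
  define K where "K u v = \<Phi>' u v + \<omega> u (\<Phi> x v)" for u v
  note Gx = G[OF assms(2)]
  note bil = inner_form_bilinear[OF Gx]
  have hx: "h x = (\<lambda>u v. G x (\<Phi> x u) (\<Phi> x v))" using h[OF assms(2)] by blast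
  have dh: "frechet_derivative (\<lambda>y. h y v z) (at x) = (\<lambda>u. G x (K u v) (\<Phi> x z) + G x (\<Phi> x v) (K u z))" for v z
  proof -
    have "((\<lambda>y. G y (\<Phi> y v) (\<Phi> y z)) has_derivative
        (\<lambda>u. G x (\<omega> u (\<Phi> x v)) (\<Phi> x z) + G x (\<Phi> x v) (\<omega> u (\<Phi> x z))
           + G x (\<Phi>' u v) (\<Phi> x z) + G x (\<Phi> x v) (\<Phi>' u z))) (at x)"
      by (rule has_derivative_bilinear_family[OF assms(1,2) inner_form_bilinear[OF G] compat d\<Phi> d\<Phi>])
    then have "((\<lambda>y. G y (\<Phi> y v) (\<Phi> y z)) has_derivative
        (\<lambda>u. G x (K u v) (\<Phi> x z) + G x (\<Phi> x v) (K u z))) (at x)"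
      by (simp add: K_def bilinear_ladd[OF bil] bilinear_radd[OF bil] add_ac)
    then have "((\<lambda>y. h y v z) has_derivative
        (\<lambda>u. G x (K u v) (\<Phi> x z) + G x (\<Phi> x v) (K u z))) (at x)"
      by (rule has_derivative_transform_within_open[OF _ assms(1,2)]) (simp add: h)
    then show ?thesis by (rule frechet_derivative_at[symmetric])
  qed
  have K: "K u v = K v u" for u v using torsion by (simp add: K_def)
  show ?thesis
    unfolding christoffel_def
  proof (rule sharp_unique)
    show "inner_form (h x)" unfolding hx by (rule inner_form_pullback[OF Gx \<Phi>])
    fix z
    have "h x C z = G x (K u v) (\<Phi> x z)" by (simp add: hx C K_def)
    then show "h x C z = (frechet_derivative (\<lambda>y. h y v z) (at x) u
      + frechet_derivative (\<lambda>y. h y u z) (at x) v - frechet_derivative (\<lambda>y. h y u v) (at x) z) / 2"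
      by (simp add: dh K[of v u] K[of z] inner_form_sym[OF Gx, of "\<Phi> x u"] inner_form_sym[OF Gx, of "\<Phi> x v"])
  qed
qed

text \<open>
  Consequently \<open>\<Phi>\<close> carries the Riemann tensor of \<open>h\<close> to the curvature \<open>d\<omega> + \<omega> \<and> \<omega>\<close>. The second
  derivatives of \<open>\<Phi>\<close> cancel by symmetry, so only first derivatives of \<open>\<omega>\<close> survive.
\<close>

lemma frame_riemann:
  fixes h :: "'e::euclidean_space bform_field" and \<Phi> :: "'e \<Rightarrow> 'e \<Rightarrow> 'f::euclidean_space"
  assumes "open U" "x \<in> U"
    and \<Phi>: "\<And>y. y \<in> U \<Longrightarrow> linear (\<Phi> y)"
    and \<omega>: "\<And>y u. y \<in> U \<Longrightarrow> linear (\<omega> y u)"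
    and d\<Phi>: "\<And>y v. y \<in> U \<Longrightarrow> ((\<lambda>y. \<Phi> y v) has_derivative (\<lambda>u. \<Phi>' y u v)) (at y)"
    and d\<Phi>': "\<And>v w. ((\<lambda>y. \<Phi>' y v w) has_derivative (\<lambda>u. \<Phi>'' u v w)) (at x)"
    and d\<omega>: "\<And>v p. ((\<lambda>y. \<omega> y v p) has_derivative (\<lambda>u. \<omega>' u v p)) (at x)"
    and \<Gamma>: "\<And>y u v. y \<in> U \<Longrightarrow> \<Phi> y (christoffel h y u v) = \<Phi>' y u v + \<omega> y u (\<Phi> y v)"
    and diff: "\<And>v w. (\<lambda>y. christoffel h y v w) differentiable (at x)"
  shows "\<Phi> x (riemann h x u v w) = \<omega>' u v (\<Phi> x w) - \<omega>' v u (\<Phi> x w)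
           + \<omega> x u (\<omega> x v (\<Phi> x w)) - \<omega> x v (\<omega> x u (\<Phi> x w))"
proof -
  let ?C = "\<lambda>v w u. frechet_derivative (\<lambda>y. christoffel h y v w) (at x) u"
  have main: "\<Phi> x (?C v w u + christoffel h x u (christoffel h x v w)) =
      \<Phi>'' u v w + \<omega>' u v (\<Phi> x w) + \<omega> x v (\<Phi>' x u w) + \<omega> x u (\<Phi>' x v w) + \<omega> x u (\<omega> x v (\<Phi> x w))" for u v
  proof -
    have 1: "((\<lambda>y. \<Phi> y (christoffel h y v w)) has_derivative
        (\<lambda>u. \<Phi>' x u (christoffel h x v w) + \<Phi> x (?C v w u))) (at x)"
      by (rule has_derivative_linear_family[OF assms(1,2) \<Phi> d\<Phi>[OF assms(2)]])
        (simp_all add: frechet_derivative_works[symmetric] diff)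
    have "((\<lambda>y. \<Phi>' y v w + \<omega> y v (\<Phi> y w)) has_derivative
        (\<lambda>u. \<Phi>'' u v w + (\<omega>' u v (\<Phi> x w) + \<omega> x v (\<Phi>' x u w)))) (at x)"
      by (intro has_derivative_add d\<Phi>' has_derivative_linear_family[OF assms(1,2) \<omega> d\<omega> d\<Phi>[OF assms(2)]])
    then have "((\<lambda>y. \<Phi> y (christoffel h y v w)) has_derivative
        (\<lambda>u. \<Phi>'' u v w + (\<omega>' u v (\<Phi> x w) + \<omega> x v (\<Phi>' x u w)))) (at x)"
      by (rule has_derivative_transform_within_open[OF _ assms(1,2)]) (simp add: \<Gamma>)
    from has_derivative_unique[OF 1 this, THEN fun_cong, of u]
    show ?thesis
      by (simp add: linear_add[OF \<Phi>[OF assms(2)]] \<Gamma>[OF assms(2)] linear_add[OF \<omega>[OF assms(2)]] algebra_simps)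
  qed
  have "\<Phi>'' u v w = \<Phi>'' v u w"
    by (rule second_derivative_symmetric[OF assms(1,2) d\<Phi> d\<Phi>'])
  moreover have "\<Phi> x (riemann h x u v w) =
     \<Phi> x (?C v w u + christoffel h x u (christoffel h x v w))
     - \<Phi> x (?C u w v + christoffel h x v (christoffel h x u w))"
    unfolding riemann_def linear_diff[OF \<Phi>[OF assms(2)], symmetric]
    by (simp add: algebra_simps)
  ultimately show ?thesis unfolding main by (simp add: algebra_simps)
qed

lemma inverse_metric_sum:
  assumes "inner_form (g x)" "linear \<alpha>"
  shows "(\<Sum>j\<in>Basis. inverse_metric g x i j * \<alpha> j) = \<alpha> (sharp g x (\<lambda>z. z \<bullet> i))"
  unfolding inverse_metric_def
  using linear_expand[OF assms(2), of "sharp g x (\<lambda>z. z \<bullet> i)"] by simp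

lemma sharp_inner:
  assumes "inner_form (g x)" shows "g x (sharp g x (\<lambda>z. z \<bullet> i)) z = z \<bullet> i"
  by (rule inner_form_sharp[where g = g and x = x, OF assms]) (simp add: linearI inner_add_left)

text \<open>
  Traces taken with the inverse metric are traces of the endomorphism \<open>S\<close> that the metric associates
  with the tensor; in this form they can be used in linear algebra.
\<close>

lemma metric_trace_operator:
  assumes g: "inner_form (g x)" and S: "\<And>u v. g x (S u) v = m x u v"
  shows "metric_trace g m x = (\<Sum>i\<in>Basis. S i \<bullet> i)"
proof -
  have lin: "linear (m x u)" for u
  proof -
    have "m x u = g x (S u)" by (simp add: fun_eq_iff S)
    then show ?thesis using bilinear_linear(1)[OF inner_form_bilinear[OF g]] by simp
  qed
  have "metric_trace g m x = (\<Sum>i\<in>Basis. m x i (sharp g x (\<lambda>z. z \<bullet> i)))"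
    unfolding metric_trace_def by (simp add: inverse_metric_sum[where g = g and x = x, OF g lin])
  also have "\<dots> = (\<Sum>i\<in>Basis. S i \<bullet> i)"
    by (simp add: S[symmetric] inner_form_sym[OF g, of "S _"] sharp_inner[where g = g and x = x, OF g])
  finally show ?thesis .
qed

lemma tensor_norm_sq_operator:
  assumes g: "inner_form (g x)" and S: "\<And>u v. g x (S u) v = m x u v" and sym: "\<And>u v. m x u v = m x v u"
  shows "tensor_norm_sq g m x = (\<Sum>i\<in>Basis. S (S i) \<bullet> i)"
proof -
  let ?s = "\<lambda>i. sharp g x (\<lambda>z. z \<bullet> i)"
  have lin: "linear (m x u)" for u
  proof -
    have "m x u = g x (S u)" by (simp add: fun_eq_iff S)
    then show ?thesis using bilinear_linear(1)[OF inner_form_bilinear[OF g]] by simp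
  qed
  have lin': "linear (\<lambda>u. m x u v)" for v
    using lin[of v] by (subst sym)
  have "tensor_norm_sq g m x = (\<Sum>i\<in>Basis. \<Sum>j\<in>Basis. m x i j * m x (?s i) (?s j))"
  proof -
    have "(\<Sum>k\<in>Basis. \<Sum>l\<in>Basis. inverse_metric g x i k * inverse_metric g x j l * m x i j * m x k l)
      = m x i j * (\<Sum>k\<in>Basis. inverse_metric g x i k * (\<Sum>l\<in>Basis. inverse_metric g x j l * m x k l))" for i j
      by (simp add: sum_distrib_left mult_ac)
    also have "\<dots> i j = m x i j * m x (?s i) (?s j)" for i j
      by (simp add: inverse_metric_sum[where g = g and x = x, OF g lin] inverse_metric_sum[where g = g and x = x, OF g lin'])
    finally show ?thesis unfolding tensor_norm_sq_def by simp
  qed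
  also have "\<dots> = (\<Sum>i\<in>Basis. m x (S (?s i)) i)"
  proof -
    have "(\<Sum>j\<in>Basis. m x i j * m x (?s i) (?s j)) = m x i (S (?s i))" for i
    proof -
      have "m x (?s i) (?s j) = S (?s i) \<bullet> j" for j
        by (simp add: S[symmetric] inner_form_sym[OF g, of "S _"] sharp_inner[where g = g and x = x, OF g])
      then show ?thesis using linear_expand[OF lin, of i "S (?s i)"] by (simp add: mult.commute)
    qed
    then show ?thesis by (simp add: sym)
  qed
  also have "\<dots> = (\<Sum>i\<in>Basis. S (S i) \<bullet> i)"
  proof -
    have "m x (S (?s i)) i = S (S i) \<bullet> i" for i
    proof -
      have "m x (S (?s i)) i = g x (S i) (S (?s i))" by (simp add: S sym)
      also have "\<dots> = m x (?s i) (S i)" by (simp add: S[symmetric] inner_form_sym[OF g])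
      also have "\<dots> = g x (S (S i)) (?s i)" by (simp add: S sym)
      also have "\<dots> = S (S i) \<bullet> i" by (simp add: inner_form_sym[OF g, of "S _"] sharp_inner[where g = g and x = x, OF g])
      finally show ?thesis .
    qed
    then show ?thesis by simp
  qed
  finally show ?thesis .
qed

lemma constant_curvature_scalar:
  fixes h :: "'e::euclidean_space bform_field"
  assumes h: "inner_form (h x)"
    and R: "\<And>u v w. riemann h x u v w = \<kappa> *\<^sub>R (h x v w *\<^sub>R u - h x u w *\<^sub>R v)"
  shows "scalar_curvature h x = \<kappa> * (DIM('e) - 1) * DIM('e)"
proof -
  have ric: "ricci h x v w = (\<kappa> * (DIM('e) - 1)) * h x v w" for v w
  proof -
    have "ricci h x v w = (\<Sum>i\<in>Basis. \<kappa> * (h x v w - (v \<bullet> i) * h x i w))"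
      unfolding ricci_def R by (intro sum.cong refl) (simp add: inner_diff_left)
    also have "\<dots> = \<kappa> * (DIM('e) * h x v w - (\<Sum>i\<in>Basis. (v \<bullet> i) * h x i w))"
      by (simp add: sum_distrib_left[symmetric] sum_subtractf)
    also have "(\<Sum>i\<in>Basis. (v \<bullet> i) * h x i w) = h x v w"
      using linear_expand[OF bilinear_linear(2)[OF inner_form_bilinear[OF h]], of v w] by simp
    finally show ?thesis by (simp add: algebra_simps)
  qed
  have "scalar_curvature h x = (\<kappa> * (DIM('e) - 1)) * metric_trace h h x"
    unfolding scalar_curvature_def metric_trace_def ric by (simp add: sum_distrib_left mult_ac)
  also have "metric_trace h h x = DIM('e)"
    using metric_trace_operator[where g = h and m = h and x = x and S = "\<lambda>u. u", OF h] by simp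
  finally show ?thesis .
qed

lemma gram_pos:
  fixes b :: "'e::euclidean_space \<Rightarrow> 'e \<Rightarrow> real"
  assumes b: "inner_form b" and ind: "u \<noteq> v" "independent {u, v}"
  shows "b u u * b v v - (b u v)\<^sup>2 > 0"
proof -
  note bil = inner_form_bilinear[OF b]
  note ex = bilinear_lsub[OF bil] bilinear_rsub[OF bil] bilinear_lmul[OF bil] bilinear_rmul[OF bil]
  have "v \<noteq> 0" using ind(2) dependent_zero by blast
  then have v: "b v v > 0" by (rule inner_form_pos[OF b])
  have "b v v *\<^sub>R u - b u v *\<^sub>R v \<noteq> 0"
  proof
    assume "b v v *\<^sub>R u - b u v *\<^sub>R v = 0"
    then have "inverse (b v v) *\<^sub>R (b v v *\<^sub>R u) = inverse (b v v) *\<^sub>R (b u v *\<^sub>R v)" by simp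
    then have "u = (b u v / b v v) *\<^sub>R v" using v by (simp add: divide_inverse mult.commute)
    then have "u \<in> span {v}" by (metis insertI1 span_base span_scale)
    moreover have "{u, v} - {u} = {v}" using ind(1) by auto
    ultimately show False using ind(2) unfolding dependent_def by auto
  qed
  then have "b (b v v *\<^sub>R u - b u v *\<^sub>R v) (b v v *\<^sub>R u - b u v *\<^sub>R v) > 0" by (rule inner_form_pos[OF b])
  also have "b (b v v *\<^sub>R u - b u v *\<^sub>R v) (b v v *\<^sub>R u - b u v *\<^sub>R v) = b v v * (b u u * b v v - (b u v)\<^sup>2)"
    by (simp add: ex inner_form_sym[OF b, of v u] power2_eq_square algebra_simps)
  finally show ?thesis using v by (simp add: zero_less_mult_iff)
qed

lemma constant_curvature_sectional:
  fixes h :: "'e::euclidean_space bform_field"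
  assumes h: "inner_form (h x)"
    and R: "\<And>u v w. riemann h x u v w = \<kappa> *\<^sub>R (h x v w *\<^sub>R u - h x u w *\<^sub>R v)"
    and ind: "u \<noteq> v" "independent {u, v}"
  shows "sectional_curvature h x u v = \<kappa>"
proof -
  note bil = inner_form_bilinear[OF h]
  have "h x (riemann h x u v v) u = \<kappa> * (h x u u * h x v v - (h x u v)\<^sup>2)"
    by (simp add: R bilinear_lsub[OF bil] bilinear_lmul[OF bil] inner_form_sym[OF h, of v u]
        power2_eq_square)
  then show ?thesis using gram_pos[OF h ind] by (simp add: sectional_curvature_def)
qed

section \<open>Surfaces\<close>

abbreviation e1 :: "real^2" where "e1 \<equiv> axis 1 1"
abbreviation e2 :: "real^2" where "e2 \<equiv> axis 2 1"

lemma plane_axis_nth: "e1 $ 1 = 1" "e1 $ 2 = 0" "e2 $ 1 = 0" "e2 $ 2 = 1"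
  by (simp_all add: axis_def)

lemma plane_expand: "(u::real^2) = u $ 1 *\<^sub>R e1 + u $ 2 *\<^sub>R e2"
  by (simp add: vec_eq_iff forall_2 axis_def)

lemma plane_Basis: "(Basis :: (real^2) set) = {e1, e2}"
  by (auto simp: Basis_vec_def exhaust_2) (metis exhaust_2)

lemma plane_axes_neq: "e1 \<noteq> e2"
  by (simp add: axis_eq_axis)

lemma plane_linear: "linear L \<Longrightarrow> L (u::real^2) = u $ 1 *\<^sub>R L e1 + u $ 2 *\<^sub>R L e2"
  by (subst plane_expand) (simp add: linear_add linear_cmul)

lemma plane_sum_Basis: "(\<Sum>i\<in>Basis. f (i::real^2)) = f e1 + f e2"
  by (simp add: plane_Basis plane_axes_neq)

lemma plane_inner: "(u::real^2) \<bullet> e1 = u $ 1" "(u::real^2) \<bullet> e2 = u $ 2"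
  by (simp_all add: inner_axis)

lemma plane_gram_pos:
  assumes "inner_form b" shows "b e1 e1 * b e2 e2 - (b e1 e2)\<^sup>2 > 0"
proof (rule gram_pos[OF assms plane_axes_neq])
  show "independent {e1, e2}"
    using independent_Basis[where 'a = "real^2"] unfolding plane_Basis .
qed

lemma plane_alternating:
  fixes A :: "real^2 \<Rightarrow> real^2 \<Rightarrow> 'b::real_vector"
  assumes A: "bilinear A" and alt: "\<And>u. A u u = 0"
  shows "A u v = (u $ 1 * v $ 2 - u $ 2 * v $ 1) *\<^sub>R A e1 e2"
proof -
  have "A e1 e2 + A e2 e1 = A (e1 + e2) (e1 + e2)"
    using alt[of e1] alt[of e2] by (simp add: bilinear_ladd[OF A] bilinear_radd[OF A])
  also have "\<dots> = 0" by (rule alt)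
  finally have skew: "A e2 e1 = - A e1 e2" by (metis add_eq_0_iff)
  have "A u v = u $ 1 *\<^sub>R A e1 v + u $ 2 *\<^sub>R A e2 v"
    by (rule plane_linear[OF bilinear_linear(2)[OF A]])
  also have "A e1 v = v $ 2 *\<^sub>R A e1 e2"
    using plane_linear[OF bilinear_linear(1)[OF A], of e1 v] by (simp add: alt)
  also have "A e2 v = - (v $ 1 *\<^sub>R A e1 e2)"
    using plane_linear[OF bilinear_linear(1)[OF A], of e2 v] by (simp add: alt skew)
  finally show ?thesis by (simp add: scaleR_left_diff_distrib)
qed

text \<open>
  Cramer's rule. It is used to see that raising an index preserves smoothness of every order.
\<close>

lemma plane_sharp:
  fixes g :: "(real^2) bform_field"
  assumes g: "inner_form (g x)" and \<alpha>: "linear \<alpha>"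
  defines "D \<equiv> g x e1 e1 * g x e2 e2 - (g x e1 e2)\<^sup>2"
  shows "sharp g x \<alpha> = (inverse D * (g x e2 e2 * \<alpha> e1 - g x e1 e2 * \<alpha> e2)) *\<^sub>R e1
    + (inverse D * (g x e1 e1 * \<alpha> e2 - g x e1 e2 * \<alpha> e1)) *\<^sub>R e2"
proof (rule sharp_unique[where g = g and x = x, OF g])
  fix z
  note bil = inner_form_bilinear[OF g]
  have D: "D \<noteq> 0" using plane_gram_pos[OF g] by (simp add: D_def)
  let ?w = "(inverse D * (g x e2 e2 * \<alpha> e1 - g x e1 e2 * \<alpha> e2)) *\<^sub>R e1
    + (inverse D * (g x e1 e1 * \<alpha> e2 - g x e1 e2 * \<alpha> e1)) *\<^sub>R e2"
  have w: "g x ?w e1 = inverse D * (D * \<alpha> e1)" "g x ?w e2 = inverse D * (D * \<alpha> e2)"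
    unfolding bilinear_ladd[OF bil] bilinear_lmul[OF bil] inner_form_sym[OF g, of e2 e1]
    by (simp_all add: D_def power2_eq_square algebra_simps)
  have "g x ?w z = z $ 1 * g x ?w e1 + z $ 2 * g x ?w e2"
    using plane_linear[OF bilinear_linear(1)[OF bil], of ?w z] by simp
  also have "\<dots> = \<alpha> z"
    unfolding w using D plane_linear[OF \<alpha>, of z] by (simp add: field_simps)
  finally show "g x ?w z = \<alpha> z" .
qed

lemma Ck_on_sharp:
  fixes g :: "(real^2) bform_field"
  assumes U: "open U" and g: "\<And>x. x \<in> U \<Longrightarrow> inner_form (g x)" "\<And>u v. Ck_on k U (\<lambda>x. g x u v)"
    and \<alpha>: "\<And>x. x \<in> U \<Longrightarrow> linear (\<alpha> x)" "\<And>z. Ck_on k U (\<lambda>x. \<alpha> x z)"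
  shows "Ck_on k U (\<lambda>x. sharp g x (\<alpha> x))"
proof -
  let ?D = "\<lambda>x. g x e1 e1 * g x e2 e2 - (g x e1 e2)\<^sup>2"
  have D: "Ck_on k U (\<lambda>x. inverse (?D x))"
    unfolding power2_eq_square
    using plane_gram_pos[OF g(1)]
    by (intro Ck_on_inverse Ck_on_diff Ck_on_mult U g(2)) (force simp: power2_eq_square)
  have "Ck_on k U (\<lambda>x. (inverse (?D x) * (g x e2 e2 * \<alpha> x e1 - g x e1 e2 * \<alpha> x e2)) *\<^sub>R e1
    + (inverse (?D x) * (g x e1 e1 * \<alpha> x e2 - g x e1 e2 * \<alpha> x e1)) *\<^sub>R e2)"
    by (intro Ck_on_add Ck_on_scaleR Ck_on_mult Ck_on_diff Ck_on_const U g(2) \<alpha>(2) D)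
  then show ?thesis
    by (rule Ck_on_cong[OF U, rotated]) (rule plane_sharp[where g = g, OF g(1) \<alpha>(1), symmetric])
qed

lemma plane_traceless_square:
  fixes S :: "real^2 \<Rightarrow> real^2"
  assumes S: "linear S" and tr: "(\<Sum>i\<in>Basis. S i \<bullet> i) = 0"
  shows "S (S u) = ((\<Sum>i\<in>Basis. S (S i) \<bullet> i) / 2) *\<^sub>R u"
proof -
  have S2: "S e2 $ 2 = - S e1 $ 1" using tr by (simp add: plane_sum_Basis plane_inner)
  have "S (S v) = (S e1 $ 1 * S e1 $ 1 + S e1 $ 2 * S e2 $ 1) *\<^sub>R v" for v
    by (subst plane_linear[OF S, of "S v"])
      (simp add: plane_linear[OF S, of v] vec_eq_iff forall_2 S2 algebra_simps)
  then show ?thesis by (simp add: plane_sum_Basis plane_inner)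
qed

text \<open>
  For the covector \<open>\<alpha>\<close>, write \<open>(u \<and> v)(\<alpha>) = \<alpha>(v) u - \<alpha>(u) v\<close>. On a plane
  \<open>Su \<and> v + u \<and> Sv = tr(S) u \<and> v\<close> and \<open>Su \<and> Sv = det(S) u \<and> v\<close>; for traceless \<open>S\<close> the first vanishes
  and Cayley-Hamilton, \<open>S\<^sup>2 = c\<close>, identifies the determinant as \<open>- c\<close>.
\<close>

lemma plane_traceless_wedge:
  fixes S :: "real^2 \<Rightarrow> real^2" and \<alpha> :: "real^2 \<Rightarrow> real"
  assumes S: "linear S" and tr: "(\<Sum>i\<in>Basis. S i \<bullet> i) = 0" and c: "\<And>u. S (S u) = c *\<^sub>R u"
    and \<alpha>: "linear \<alpha>"
  shows "\<alpha> v *\<^sub>R S u - \<alpha> (S u) *\<^sub>R v + (\<alpha> (S v) *\<^sub>R u - \<alpha> u *\<^sub>R S v) = 0"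
    and "\<alpha> (S v) *\<^sub>R S u - \<alpha> (S u) *\<^sub>R S v = - c *\<^sub>R (\<alpha> v *\<^sub>R u - \<alpha> u *\<^sub>R v)"
proof -
  have S2: "S e2 $ 2 = - S e1 $ 1" using tr by (simp add: plane_sum_Basis plane_inner)
  have Sc: "S w $ 1 = w $ 1 * S e1 $ 1 + w $ 2 * S e2 $ 1" "S w $ 2 = w $ 1 * S e1 $ 2 - w $ 2 * S e1 $ 1" for w
    using arg_cong[OF plane_linear[OF S, of w], of "\<lambda>v. v $ 1"]
      arg_cong[OF plane_linear[OF S, of w], of "\<lambda>v. v $ 2"] by (simp_all add: S2)
  have \<alpha>c: "\<alpha> w = w $ 1 * \<alpha> e1 + w $ 2 * \<alpha> e2" for w
    using plane_linear[OF \<alpha>, of w] by simp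
  have "S (S e1) = (S e1 $ 1 * S e1 $ 1 + S e1 $ 2 * S e2 $ 1) *\<^sub>R e1"
    by (subst plane_linear[OF S, of "S e1"])
      (simp add: vec_eq_iff forall_2 S2 plane_axis_nth algebra_simps)
  then have l: "c = S e1 $ 1 * S e1 $ 1 + S e1 $ 2 * S e2 $ 1"
    by (simp add: c axis_eq_0_iff)
  show "\<alpha> v *\<^sub>R S u - \<alpha> (S u) *\<^sub>R v + (\<alpha> (S v) *\<^sub>R u - \<alpha> u *\<^sub>R S v) = 0"
    by (simp add: \<alpha>c[of u] \<alpha>c[of v] \<alpha>c[of "S u"] \<alpha>c[of "S v"] Sc[of u] Sc[of v] vec_eq_iff forall_2 S2 algebra_simps)
  show "\<alpha> (S v) *\<^sub>R S u - \<alpha> (S u) *\<^sub>R S v = - c *\<^sub>R (\<alpha> v *\<^sub>R u - \<alpha> u *\<^sub>R v)"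
    by (simp add: \<alpha>c[of u] \<alpha>c[of v] \<alpha>c[of "S u"] \<alpha>c[of "S v"] Sc[of u] Sc[of v] vec_eq_iff forall_2 S2 l algebra_simps)
qed

locale smooth_surface_metric =
  fixes U :: "(real^2) set" and g :: "(real^2) bform_field"
  assumes U: "open U"
    and form: "\<And>x. x \<in> U \<Longrightarrow> inner_form (g x)"
    and Ck_g: "\<And>k u v. Ck_on k U (\<lambda>x. g x u v)"
begin

lemma diff_g: "x \<in> U \<Longrightarrow> (\<lambda>y. g y u v) differentiable (at x)"
  using Ck_g[of 1] by simp

lemmas bil = inner_form_bilinear[OF form]

lemma Gamma_sym: "x \<in> U \<Longrightarrow> christoffel g x u v = christoffel g x v u"
  using levi_civita(1)[OF U _ form diff_g] .

lemma Gamma_bilinear: "x \<in> U \<Longrightarrow> bilinear (christoffel g x)"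
  using levi_civita(3)[OF U _ form diff_g] .

lemma deriv_g: "x \<in> U \<Longrightarrow> ((\<lambda>y. g y v w) has_derivative
    (\<lambda>u. g x (christoffel g x u v) w + g x v (christoffel g x u w))) (at x)"
  using levi_civita(2)[OF U _ form diff_g] .

lemma Ck_Gamma: "Ck_on k U (\<lambda>x. christoffel g x u v)"
proof -
  have "Ck_on k U (\<lambda>x. frechet_derivative (\<lambda>y. g y p q) (at x) w)" for p q w
    using Ck_g[of "Suc k"] by simp
  note d = this
  have "Ck_on k U (\<lambda>x. (1/2) * (frechet_derivative (\<lambda>y. g y v z) (at x) u
      + frechet_derivative (\<lambda>y. g y u z) (at x) v - frechet_derivative (\<lambda>y. g y u v) (at x) z))" for z
    by (intro Ck_on_mult Ck_on_const Ck_on_diff Ck_on_add U d)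
  then show ?thesis
    unfolding christoffel_def
    by (intro Ck_on_sharp[OF U form Ck_g] koszul_linear(3)[OF U _ form diff_g]) simp_all
qed

definition dGamma :: "real^2 \<Rightarrow> real^2 \<Rightarrow> real^2 \<Rightarrow> real^2 \<Rightarrow> real^2" where
  "dGamma x u v w = frechet_derivative (\<lambda>y. christoffel g y v w) (at x) u"

lemma deriv_Gamma: "x \<in> U \<Longrightarrow> ((\<lambda>y. christoffel g y v w) has_derivative (\<lambda>u. dGamma x u v w)) (at x)"
  using Ck_on_Suc_derivative[OF Ck_Gamma] by (simp add: dGamma_def)

text \<open>
  The curvature tensor \<open>g(R(u,v)w, z)\<close> is alternating in \<open>(u, v)\<close> and in \<open>(w, z)\<close>, and alternating
  forms on a plane make up a line. So it is a multiple of \<open>g(v,w) g(u,z) - g(u,w) g(v,z)\<close>, and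
  contraction identifies the factor as half the scalar curvature.
\<close>

lemma gauss_curvature:
  assumes x: "x \<in> U"
  shows "riemann g x u v w = (scalar_curvature g x / 2) *\<^sub>R (g x v w *\<^sub>R u - g x u w *\<^sub>R v)"
proof -
  let ?R = "riemann g x"
  note bx = bil[OF x] and Gb = Gamma_bilinear[OF x]
  note ex = bilinear_ladd[OF bx] bilinear_radd[OF bx] bilinear_lmul[OF bx] bilinear_rmul[OF bx]
    bilinear_lsub[OF bx] bilinear_rsub[OF bx]
  note exG = bilinear_ladd[OF Gb] bilinear_radd[OF Gb] bilinear_lmul[OF Gb] bilinear_rmul[OF Gb]
  have skew: "g x (?R u v w) z = - g x w (?R u v z)" for u v w z
    using Ck_Gamma[of 1] x by (intro riemann_skew[OF U x form diff_g]) auto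
  have R: "?R u v w = dGamma x u v w - dGamma x v u w + christoffel g x u (christoffel g x v w)
      - christoffel g x v (christoffel g x u w)" for u v w
    by (simp add: riemann_def dGamma_def)
  have l1: "linear (\<lambda>u. dGamma x u v w)" for v w
    using has_derivative_linear[OF deriv_Gamma[OF x]] .
  have l2: "linear (\<lambda>v. dGamma x u v w)" for u w
    by (rule linear_family_derivative_linear[OF U x, where L = "\<lambda>y v. christoffel g y v w"])
      (auto intro: deriv_Gamma[OF x] bilinear_linear Gamma_bilinear)
  have "bilinear (\<lambda>u v. ?R u v w)" for w
    unfolding bilinear_def R
    by (auto intro!: linearI simp: linear_add[OF l1] linear_add[OF l2] linear_cmul[OF l1]
        linear_cmul[OF l2] exG algebra_simps)
  then have alt: "?R u v w = (u $ 1 * v $ 2 - u $ 2 * v $ 1) *\<^sub>R ?R e1 e2 w" for u v w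
    by (rule plane_alternating) (simp add: R)
  define P where "P = ?R e1 e2"
  have "bilinear (\<lambda>w z. g x w (P z))"
    unfolding bilinear_def
  proof (intro conjI allI)
    show "linear (\<lambda>w. g x w (P z))" for z by (rule bilinear_linear(2)[OF bx])
    have "(\<lambda>z. g x w (P z)) = (\<lambda>z. - g x (P w) z)" for w
      using skew[of e1 e2 w] by (simp add: P_def fun_eq_iff)
    then show "linear (\<lambda>z. g x w (P z))" for w
      by (simp add: linear_compose_neg bilinear_linear(1)[OF bx])
  qed
  moreover have "g x w (P w) = 0" for w
    using skew[of e1 e2 w w] by (simp add: P_def inner_form_sym[OF form[OF x], of w])
  ultimately have P: "g x w (P z) = (w $ 1 * z $ 2 - w $ 2 * z $ 1) *\<^sub>R g x e1 (P e2)" for w z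
    by (rule plane_alternating)
  define D where "D = g x e1 e1 * g x e2 e2 - (g x e1 e2)\<^sup>2"
  have D: "D > 0" unfolding D_def by (rule plane_gram_pos[OF form[OF x]])
  define \<rho> where "\<rho> = g x e1 (P e2) / D"
  have Pw: "P w = \<rho> *\<^sub>R (g x e2 w *\<^sub>R e1 - g x e1 w *\<^sub>R e2)" for w
  proof (rule inner_form_eqI[OF form[OF x]])
    fix z
    have "g x (P w) z = g x z (P w)" by (rule inner_form_sym[OF form[OF x]])
    also have "\<dots> = \<rho> * ((z $ 1 * w $ 2 - z $ 2 * w $ 1) * D)"
      unfolding P[of z w] using D by (simp add: \<rho>_def)
    also have "(z $ 1 * w $ 2 - z $ 2 * w $ 1) * D = g x e2 w * g x e1 z - g x e1 w * g x e2 z"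
      using plane_linear[OF bilinear_linear(1)[OF bx], of e1 w] plane_linear[OF bilinear_linear(1)[OF bx], of e2 w]
        plane_linear[OF bilinear_linear(1)[OF bx], of e1 z] plane_linear[OF bilinear_linear(1)[OF bx], of e2 z]
      by (simp add: D_def inner_form_sym[OF form[OF x], of e2 e1] power2_eq_square algebra_simps)
    finally show "g x (P w) z = g x (\<rho> *\<^sub>R (g x e2 w *\<^sub>R e1 - g x e1 w *\<^sub>R e2)) z"
      by (simp add: ex)
  qed
  have main: "?R u v w = \<rho> *\<^sub>R (g x v w *\<^sub>R u - g x u w *\<^sub>R v)" for u v w
  proof -
    have "?R u v w = (u $ 1 * v $ 2 - u $ 2 * v $ 1) *\<^sub>R \<rho> *\<^sub>R (g x e2 w *\<^sub>R e1 - g x e1 w *\<^sub>R e2)"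
      unfolding alt[of u v w] by (simp only: P_def[symmetric] Pw)
    moreover have "g x v w *\<^sub>R u - g x u w *\<^sub>R v
        = (u $ 1 * v $ 2 - u $ 2 * v $ 1) *\<^sub>R (g x e2 w *\<^sub>R e1 - g x e1 w *\<^sub>R e2)"
      by (rule plane_alternating)
        (auto simp: bilinear_def ex algebra_simps intro!: linearI)
    ultimately show ?thesis by (simp add: mult.commute)
  qed
  then have "scalar_curvature g x = \<rho> * (DIM(real^2) - 1) * DIM(real^2)"
    by (rule constant_curvature_scalar[where h = g, OF form[OF x]])
  then show ?thesis using main by simp
qed

end

section \<open>Minimal germs in a chart\<close>

text \<open>
  Solutions of \<open>f'' = f / 6\<close>, normalised by \<open>cs 0 = 1\<close>, \<open>cs' 0 = 0\<close> and \<open>sn 0 = 0\<close>, \<open>sn' 0 = 1\<close>. In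
  dimension three, scalar curvature \<open>-1\<close> means sectional curvature \<open>-1/6\<close>.
\<close>

definition cs :: "real \<Rightarrow> real" where "cs t = cosh (t / sqrt 6)"
definition sn :: "real \<Rightarrow> real" where "sn t = sqrt 6 * sinh (t / sqrt 6)"

lemma cs_sn_0: "cs 0 = 1" "sn 0 = 0"
  by (simp_all add: cs_def sn_def)

lemma cs_sn_pythagoras: "(cs t)\<^sup>2 - (sn t)\<^sup>2 / 6 = 1"
  using hyperbolic_pythagoras[of "t / sqrt 6"] by (simp add: cs_def sn_def power_mult_distrib)

lemma has_derivative_cs: "((\<lambda>p. cs (snd p)) has_derivative (\<lambda>X. snd X * (sn (snd p) / 6))) (at p)"
proof -
  have "(cs has_real_derivative sn t / 6) (at t)" for t
  proof -
    have "sqrt 6 * sqrt 6 = 6" by simp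
    then have "1 / sqrt 6 = sqrt 6 / 6" by (simp add: field_simps)
    then show ?thesis unfolding cs_def sn_def by (auto intro!: derivative_eq_intros)
  qed
  then have "(cs has_derivative (\<lambda>d. d * (sn (snd p) / 6))) (at (snd p))"
    unfolding mult_commute_abs by (rule has_field_derivative_imp_has_derivative)
  from has_derivative_compose[OF has_derivative_snd[OF has_derivative_ident] this] show ?thesis .
qed

lemma has_derivative_sn: "((\<lambda>p. sn (snd p)) has_derivative (\<lambda>X. snd X * cs (snd p))) (at p)"
proof -
  have "(sn has_real_derivative cs t) (at t)" for t
    unfolding cs_def sn_def by (auto intro!: derivative_eq_intros)
  then have "(sn has_derivative (\<lambda>d. d * cs (snd p))) (at (snd p))"
    unfolding mult_commute_abs by (rule has_field_derivative_imp_has_derivative)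
  from has_derivative_compose[OF has_derivative_snd[OF has_derivative_ident] this] show ?thesis .
qed

lemma Ck_on_cs_sn: "Ck_on k UNIV cs" "Ck_on k UNIV sn"
proof -
  have "Ck_on k UNIV (\<lambda>t. 1/2 * exp (1 / sqrt 6 * t) + 1/2 * exp (- 1 / sqrt 6 * t))"
    by (intro Ck_on_add Ck_on_exp open_UNIV)
  then show "Ck_on k UNIV cs"
    by (rule Ck_on_cong[OF open_UNIV, rotated]) (simp add: cs_def cosh_def field_simps)
  have "Ck_on k UNIV (\<lambda>t. sqrt 6 * 1/2 * exp (1 / sqrt 6 * t) + (- sqrt 6 * 1/2) * exp (- 1 / sqrt 6 * t))"
    by (intro Ck_on_add Ck_on_exp open_UNIV)
  then show "Ck_on k UNIV sn"
    by (rule Ck_on_cong[OF open_UNIV, rotated]) (simp add: sn_def sinh_def field_simps)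
qed

lemma has_derivative_on_fst:
  "(f has_derivative f') (at (fst p)) \<Longrightarrow> ((\<lambda>p. f (fst p)) has_derivative (\<lambda>X. f' (fst X))) (at p)"
  by (rule has_derivative_compose[OF has_derivative_fst[OF has_derivative_ident]])

definition shape_operator :: "'e::euclidean_space bform_field \<Rightarrow> 'e bform_field \<Rightarrow> 'e \<Rightarrow> 'e \<Rightarrow> 'e" where
  "shape_operator g m x u = sharp g x (m x u)"

text \<open>
  For a traceless symmetric tensor on a surface this is minus the determinant of the shape operator.
\<close>

definition half_norm_sq :: "'e::euclidean_space bform_field \<Rightarrow> 'e bform_field \<Rightarrow> 'e \<Rightarrow> real" where
  "half_norm_sq g m x = tensor_norm_sq g m x / 2"

text \<open>
  This is \<open>g(Bu, Bv) + dt\<^sup>2\<close> with \<open>B = cs(t) + sn(t) S\<close>, expanded by means of \<open>S\<^sup>2 = |m|\<^sup>2 / 2\<close>. In the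
  expanded form it is visibly smooth, and visibly independent of coordinates.
\<close>

definition cylinder_metric ::
  "'e::euclidean_space bform_field \<Rightarrow> 'e bform_field \<Rightarrow> ('e \<times> real) bform_field" where
  "cylinder_metric g m p X Y =
     ((cs (snd p))\<^sup>2 + half_norm_sq g m (fst p) * (sn (snd p))\<^sup>2) * g (fst p) (fst X) (fst Y)
     + 2 * cs (snd p) * sn (snd p) * m (fst p) (fst X) (fst Y) + snd X * snd Y"

text \<open>
  The inequality says \<open>det B > 0\<close>.
\<close>

definition nondegenerate_region :: "'e::euclidean_space bform_field \<Rightarrow> 'e bform_field \<Rightarrow> 'e set \<Rightarrow> ('e \<times> real) set" where
  "nondegenerate_region g m U =
     {p. fst p \<in> U \<and> half_norm_sq g m (fst p) * (sn (snd p))\<^sup>2 < (cs (snd p))\<^sup>2}"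

locale minimal_germ_chart = smooth_surface_metric +
  fixes m :: "(real^2) bform_field"
  assumes m_bilinear: "\<And>x. x \<in> U \<Longrightarrow> bilinear (m x)"
    and m_sym: "\<And>x u v. x \<in> U \<Longrightarrow> m x u v = m x v u"
    and Ck_m: "\<And>k u v. Ck_on k U (\<lambda>x. m x u v)"
    and codazzi: "\<And>x w u v. x \<in> U \<Longrightarrow> cov_deriv g m x w u v = cov_deriv g m x u w v"
    and gauss: "\<And>x. x \<in> U \<Longrightarrow> scalar_curvature g x + tensor_norm_sq g m x + 1 / 3 = 0"
    and minimal: "\<And>x. x \<in> U \<Longrightarrow> metric_trace g m x = 0"
begin

abbreviation "S \<equiv> shape_operator g m"
abbreviation "lam \<equiv> half_norm_sq g m"
abbreviation "Gam \<equiv> christoffel g"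
abbreviation "h \<equiv> cylinder_metric g m"
abbreviation "V \<equiv> nondegenerate_region g m U"

lemma shape: "x \<in> U \<Longrightarrow> g x (S x u) v = m x u v"
  unfolding shape_operator_def by (rule inner_form_sharp[where g = g, OF form bilinear_linear(1)[OF m_bilinear]])

lemma shape_adjoint: "x \<in> U \<Longrightarrow> g x (S x u) v = g x u (S x v)"
  using inner_form_sym[OF form] m_sym shape by metis

lemma shape_linear:
  assumes x: "x \<in> U" shows "linear (S x)"
  by (rule linearI; rule inner_form_eqI[OF form[OF x]])
    (simp_all add: shape[OF x] bilinear_ladd[OF bil[OF x]] bilinear_lmul[OF bil[OF x]]
      bilinear_ladd[OF m_bilinear[OF x]] bilinear_lmul[OF m_bilinear[OF x]])

lemma shape_traceless: "x \<in> U \<Longrightarrow> (\<Sum>i\<in>Basis. S x i \<bullet> i) = 0"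
  using metric_trace_operator[where g = g and m = m and x = x, OF form shape] minimal by simp

lemma lam_eq: "x \<in> U \<Longrightarrow> lam x = (\<Sum>i\<in>Basis. S x (S x i) \<bullet> i) / 2"
  unfolding half_norm_sq_def
  using tensor_norm_sq_operator[where g = g and m = m and x = x, OF form shape m_sym] by simp

lemma shape_square: "x \<in> U \<Longrightarrow> S x (S x u) = lam x *\<^sub>R u"
  unfolding lam_eq by (rule plane_traceless_square[OF shape_linear shape_traceless])

lemma curvature: "x \<in> U \<Longrightarrow> scalar_curvature g x / 2 = - 1 / 6 - lam x"
  using gauss[of x] by (simp add: half_norm_sq_def)

lemma Ck_shape: "Ck_on k U (\<lambda>x. S x u)"
  unfolding shape_operator_def
  by (intro Ck_on_sharp U form Ck_g Ck_m bilinear_linear(1) m_bilinear)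

lemma Ck_lam: "Ck_on k U lam"
proof -
  have c: "Ck_on k U (\<lambda>x. S x u \<bullet> v)" for u v
    by (rule Ck_on_bilinear[OF U bounded_bilinear_inner Ck_shape Ck_on_const])
  have "Ck_on k U (\<lambda>x. 1/2 * (\<Sum>i\<in>Basis. \<Sum>j\<in>Basis. (S x i \<bullet> j) * (S x j \<bullet> i)))"
    by (intro Ck_on_sum Ck_on_mult Ck_on_const c U finite_Basis)
  then show ?thesis
  proof (rule Ck_on_cong[OF U, rotated])
    fix x assume x: "x \<in> U"
    have "S x (S x i) \<bullet> i = (\<Sum>j\<in>Basis. (S x i \<bullet> j) * (S x j \<bullet> i))" for i
      by (subst linear_expand[OF shape_linear[OF x], of "S x i"]) (simp add: inner_sum_left)
    then show "1/2 * (\<Sum>i\<in>Basis. \<Sum>j\<in>Basis. (S x i \<bullet> j) * (S x j \<bullet> i)) = lam x"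
      by (simp add: lam_eq[OF x])
  qed
qed

definition dS :: "real^2 \<Rightarrow> real^2 \<Rightarrow> real^2 \<Rightarrow> real^2" where
  "dS x u v = frechet_derivative (\<lambda>y. S y v) (at x) u"
definition ddS :: "real^2 \<Rightarrow> real^2 \<Rightarrow> real^2 \<Rightarrow> real^2 \<Rightarrow> real^2" where
  "ddS x u v w = frechet_derivative (\<lambda>y. dS y v w) (at x) u"

lemma deriv_S: "x \<in> U \<Longrightarrow> ((\<lambda>y. S y v) has_derivative (\<lambda>u. dS x u v)) (at x)"
  using Ck_on_Suc_derivative[OF Ck_shape] by (simp add: dS_def)

lemma Ck_dS: "Ck_on k U (\<lambda>x. dS x u v)"
  using Ck_shape[of "Suc k"] by (simp add: dS_def)

lemma deriv_dS: "x \<in> U \<Longrightarrow> ((\<lambda>y. dS y v w) has_derivative (\<lambda>u. ddS x u v w)) (at x)"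
  using Ck_on_Suc_derivative[OF Ck_dS] by (simp add: ddS_def)

text \<open>
  The Codazzi equation for \<open>m\<close> with one index raised, \<open>(\<nabla>\<^sub>u S)v = (\<nabla>\<^sub>v S)u\<close>. The terms
  \<open>S(\<nabla>\<^sub>u v)\<close> are symmetric in \<open>u\<close> and \<open>v\<close> and have cancelled.
\<close>

lemma codazzi_shape:
  assumes x: "x \<in> U"
  shows "dS x u v + Gam x u (S x v) = dS x v u + Gam x v (S x u)"
proof (rule inner_form_eqI[OF form[OF x]])
  fix z
  have "cov_deriv g m x u v z = g x (dS x u v + Gam x u (S x v)) z - m x (Gam x u v) z" for u v
  proof -
    have "((\<lambda>y. g y (S y v) z) has_derivative (\<lambda>u. g x (Gam x u (S x v)) z + g x (S x v) (Gam x u z)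
        + g x (dS x u v) z + g x (S x v) 0)) (at x)"
      by (rule has_derivative_bilinear_family[OF U x bil deriv_g[OF x] deriv_S[OF x] has_derivative_const])
    then have "((\<lambda>y. m y v z) has_derivative (\<lambda>u. g x (Gam x u (S x v)) z + g x (S x v) (Gam x u z)
        + g x (dS x u v) z + g x (S x v) 0)) (at x)"
      by (rule has_derivative_transform_within_open[OF _ U x]) (simp add: shape)
    from frechet_derivative_at[OF this, symmetric] show ?thesis
      by (simp add: cov_deriv_def bilinear_rzero[OF bil[OF x]] bilinear_ladd[OF bil[OF x]] shape[OF x])
  qed
  with codazzi[OF x, of u v z] show "g x (dS x u v + Gam x u (S x v)) z = g x (dS x v u + Gam x v (S x u)) z"
    by (simp add: Gamma_sym[OF x, of v u])
qed

text \<open>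
  \<open>B\<close> solves the Jacobi equation \<open>B'' = B / 6\<close> along the normal geodesics with \<open>B = 1\<close> and \<open>B' = S\<close> at
  \<open>t = 0\<close>; \<open>B'\<close> is its derivative in \<open>t\<close>, and \<open>dB\<close>, \<open>dB'\<close> are the full coordinate derivatives in the
  direction \<open>X\<close>.
\<close>

definition B :: "(real^2) \<times> real \<Rightarrow> real^2 \<Rightarrow> real^2" where
  "B p u = cs (snd p) *\<^sub>R u + sn (snd p) *\<^sub>R S (fst p) u"
definition B' :: "(real^2) \<times> real \<Rightarrow> real^2 \<Rightarrow> real^2" where
  "B' p u = (sn (snd p) / 6) *\<^sub>R u + cs (snd p) *\<^sub>R S (fst p) u"
definition dB :: "(real^2) \<times> real \<Rightarrow> (real^2) \<times> real \<Rightarrow> real^2 \<Rightarrow> real^2" where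
  "dB p X u = snd X *\<^sub>R B' p u + sn (snd p) *\<^sub>R dS (fst p) (fst X) u"
definition dB' :: "(real^2) \<times> real \<Rightarrow> (real^2) \<times> real \<Rightarrow> real^2 \<Rightarrow> real^2" where
  "dB' p X u = (snd X / 6) *\<^sub>R B p u + cs (snd p) *\<^sub>R dS (fst p) (fst X) u"
definition detB :: "(real^2) \<times> real \<Rightarrow> real" where
  "detB p = (cs (snd p))\<^sup>2 - lam (fst p) * (sn (snd p))\<^sup>2"

text \<open>
  The bundle \<open>T\<Sigma> \<oplus> \<real>\<close>, pulled back to the cylinder, with its metric \<open>g + dt\<^sup>2\<close>, the isomorphism
  \<open>(u, a) \<mapsto> (Bu, a)\<close> from the tangent bundle, and the connection form. The off-diagonal part of the
  connection is \<open>B'\<close>, the shape operator of the slices transported by \<open>B\<close>; since \<open>g\<close> and \<open>\<Gamma>\<close> do not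
  depend on \<open>t\<close>, nothing else appears.
\<close>

definition frame :: "(real^2) \<times> real \<Rightarrow> (real^2) \<times> real \<Rightarrow> (real^2) \<times> real" where
  "frame p X = (B p (fst X), snd X)"
definition fibre_metric :: "((real^2) \<times> real) bform_field" where
  "fibre_metric p P Q = g (fst p) (fst P) (fst Q) + snd P * snd Q"
definition conn :: "(real^2) \<times> real \<Rightarrow> (real^2) \<times> real \<Rightarrow> (real^2) \<times> real \<Rightarrow> (real^2) \<times> real" where
  "conn p X P = (Gam (fst p) (fst X) (fst P) + snd P *\<^sub>R B' p (fst X), - g (fst p) (B' p (fst X)) (fst P))"

lemma region_D: "p \<in> V \<Longrightarrow> fst p \<in> U" "p \<in> V \<Longrightarrow> detB p > 0"
  by (auto simp: nondegenerate_region_def detB_def)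

lemma detB_differentiable: "fst p \<in> U \<Longrightarrow> detB differentiable (at p)"
proof -
  assume p: "fst p \<in> U"
  have "lam differentiable (at (fst p))" using Ck_lam[of 1] p by simp
  then have "((\<lambda>p. lam (fst p)) has_derivative (\<lambda>X. frechet_derivative lam (at (fst p)) (fst X))) (at p)"
    by (intro has_derivative_on_fst) (simp add: frechet_derivative_works[symmetric])
  then have l: "(\<lambda>p. lam (fst p)) differentiable (at p)" by (rule differentiableI)
  have c: "(\<lambda>p. cs (snd p)) differentiable (at p)" "(\<lambda>p. sn (snd p)) differentiable (at p)"
    using has_derivative_cs has_derivative_sn differentiableI by blast+
  show ?thesis unfolding detB_def[abs_def] using l c by simp
qed

lemma open_V: "open V"
proof -
  have W: "open (U \<times> (UNIV :: real set))" using U by (simp add: open_Times)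
  have "continuous_on (U \<times> UNIV) detB"
    by (intro continuous_at_imp_continuous_on ballI differentiable_imp_continuous_within detB_differentiable) auto
  then have "open (detB -` {0<..} \<inter> (U \<times> UNIV))"
    using W by (metis continuous_on_open_vimage open_greaterThan)
  moreover have "detB -` {0<..} \<inter> (U \<times> UNIV) = V"
    by (auto simp: nondegenerate_region_def detB_def)
  ultimately show ?thesis by simp
qed

lemma B_linear: "fst p \<in> U \<Longrightarrow> linear (B p)"
  by (auto intro!: linearI simp: B_def linear_add[OF shape_linear] linear_cmul[OF shape_linear] algebra_simps)

text \<open>
  Cayley-Hamilton: \<open>(cs + sn S)(cs - sn S) = cs\<^sup>2 - sn\<^sup>2 S\<^sup>2\<close> is the scalar \<open>det B\<close>. The explicit inverse
  is also what makes the Christoffel symbols of the cylinder metric differentiable.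
\<close>

lemma B_inverse:
  assumes "fst p \<in> U" "detB p \<noteq> 0"
  shows "B p (inverse (detB p) *\<^sub>R (cs (snd p) *\<^sub>R u - sn (snd p) *\<^sub>R S (fst p) u)) = u"
proof -
  have "B p (cs (snd p) *\<^sub>R u - sn (snd p) *\<^sub>R S (fst p) u) = detB p *\<^sub>R u"
    by (simp add: B_def detB_def linear_diff[OF shape_linear[OF assms(1)]] linear_cmul[OF shape_linear[OF assms(1)]]
        shape_square[OF assms(1)] power2_eq_square algebra_simps)
  then show ?thesis using assms(2) by (simp add: linear_cmul[OF B_linear[OF assms(1)]])
qed

lemma B_inj:
  assumes p: "fst p \<in> U" "detB p \<noteq> 0"
  shows "inj (B p)"
proof -
  have "surj (B p)" using B_inverse[OF assms] by (rule surjI)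
  then show ?thesis using B_linear[OF p(1)] linear_surjective_imp_injective by blast
qed

lemma frame_linear: "p \<in> V \<Longrightarrow> linear (frame p)"
  by (auto intro!: linearI simp: frame_def linear_add[OF B_linear[OF region_D(1)]] linear_cmul[OF B_linear[OF region_D(1)]])

lemma frame_inj: "p \<in> V \<Longrightarrow> inj (frame p)"
  using B_inj[of p] region_D[of p] by (auto simp: inj_def frame_def prod_eq_iff)

lemma fibre_metric_form: "fst p \<in> U \<Longrightarrow> inner_form (fibre_metric p)"
proof -
  assume p: "fst p \<in> U"
  note b = bil[OF p]
  have "fibre_metric p P P > 0" if "P \<noteq> 0" for P
  proof (cases "fst P = 0")
    case True
    then have "snd P \<noteq> 0" using that by (simp add: prod_eq_iff)
    then have "snd P * snd P > 0" by (metis not_real_square_gt_zero)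
    then show ?thesis using True by (simp add: fibre_metric_def bilinear_lzero[OF b])
  next
    case False
    then show ?thesis using inner_form_pos[OF form[OF p], of "fst P"] by (simp add: fibre_metric_def add_pos_nonneg)
  qed
  then show ?thesis
    unfolding inner_form_def bilinear_def fibre_metric_def
    by (auto intro!: linearI simp: inner_form_sym[OF form[OF p]] bilinear_ladd[OF b] bilinear_radd[OF b]
        bilinear_lmul[OF b] bilinear_rmul[OF b] algebra_simps)
qed

lemma h_frame:
  assumes "p \<in> V"
  shows "h p X Y = fibre_metric p (frame p X) (frame p Y)"
proof -
  have p: "fst p \<in> U" using region_D assms by blast
  note b = bil[OF p]
  have ms: "m (fst p) a c = g (fst p) a (S (fst p) c)" for a c
    using shape[OF p] shape_adjoint[OF p] by simp
  have ss: "g (fst p) (S (fst p) a) (S (fst p) c) = lam (fst p) * g (fst p) a c" for a c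
    by (simp add: shape_adjoint[OF p] shape_square[OF p] bilinear_rmul[OF b])
  show ?thesis
    by (simp add: cylinder_metric_def fibre_metric_def frame_def B_def bilinear_ladd[OF b] bilinear_radd[OF b]
        bilinear_lmul[OF b] bilinear_rmul[OF b] ss)
      (simp add: ms shape_adjoint[OF p] power2_eq_square algebra_simps)
qed

lemma h_form: "p \<in> V \<Longrightarrow> inner_form (h p)"
proof -
  assume p: "p \<in> V"
  have "h p = (\<lambda>X Y. fibre_metric p (frame p X) (frame p Y))" using h_frame[OF p] by blast
  then show ?thesis
    using inner_form_pullback[OF fibre_metric_form[OF region_D(1)[OF p]] frame_linear[OF p] frame_inj[OF p]] by simp
qed

lemma deriv_B: "fst p \<in> U \<Longrightarrow> ((\<lambda>p. B p u) has_derivative (\<lambda>X. dB p X u)) (at p)"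
proof -
  assume p: "fst p \<in> U"
  have "((\<lambda>p. B p u) has_derivative (\<lambda>X. (snd X * (sn (snd p) / 6)) *\<^sub>R u
      + (sn (snd p) *\<^sub>R dS (fst p) (fst X) u + (snd X * cs (snd p)) *\<^sub>R S (fst p) u))) (at p)"
    unfolding B_def
    by (intro has_derivative_add has_derivative_scaleR has_derivative_scaleR_left has_derivative_cs has_derivative_sn
        has_derivative_on_fst[OF deriv_S[OF p]])
  then show ?thesis by (simp add: dB_def B'_def algebra_simps)
qed

lemma deriv_B': "fst p \<in> U \<Longrightarrow> ((\<lambda>p. B' p u) has_derivative (\<lambda>X. dB' p X u)) (at p)"
proof -
  assume p: "fst p \<in> U"
  have "((\<lambda>p. (1/6) *\<^sub>R sn (snd p) *\<^sub>R u + cs (snd p) *\<^sub>R S (fst p) u) has_derivative (\<lambda>X. (1/6) *\<^sub>R (snd X * cs (snd p)) *\<^sub>R u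
      + (cs (snd p) *\<^sub>R dS (fst p) (fst X) u + (snd X * (sn (snd p) / 6)) *\<^sub>R S (fst p) u))) (at p)"
    by (intro has_derivative_add has_derivative_scaleR has_derivative_scaleR_left has_derivative_scaleR_right
        has_derivative_cs has_derivative_sn has_derivative_on_fst[OF deriv_S[OF p]])
  then show ?thesis by (simp add: dB'_def B_def B'_def algebra_simps)
qed

text \<open>
  The Codazzi property passes from \<open>S\<close> to \<open>B\<close> and \<open>B'\<close>, since these are combinations of \<open>S\<close> and the
  identity with coefficients that are constant along the slices.
\<close>

lemma codazzi_B:
  assumes p: "fst p \<in> U"
  shows "sn (snd p) *\<^sub>R dS (fst p) u v + Gam (fst p) u (B p v) = sn (snd p) *\<^sub>R dS (fst p) v u + Gam (fst p) v (B p u)"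
proof -
  note Gb = Gamma_bilinear[OF p]
  have e: "sn (snd p) *\<^sub>R dS (fst p) u v + Gam (fst p) u (B p v)
     = cs (snd p) *\<^sub>R Gam (fst p) u v + sn (snd p) *\<^sub>R (dS (fst p) u v + Gam (fst p) u (S (fst p) v))" for u v
    by (simp add: B_def bilinear_radd[OF Gb] bilinear_rmul[OF Gb] algebra_simps)
  show ?thesis unfolding e codazzi_shape[OF p, of u v] Gamma_sym[OF p, of u v] ..
qed

lemma codazzi_B':
  assumes p: "fst p \<in> U"
  shows "cs (snd p) *\<^sub>R dS (fst p) u v + Gam (fst p) u (B' p v) = cs (snd p) *\<^sub>R dS (fst p) v u + Gam (fst p) v (B' p u)"
proof -
  note Gb = Gamma_bilinear[OF p]
  have e: "cs (snd p) *\<^sub>R dS (fst p) u v + Gam (fst p) u (B' p v)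
     = (sn (snd p) / 6) *\<^sub>R Gam (fst p) u v + cs (snd p) *\<^sub>R (dS (fst p) u v + Gam (fst p) u (S (fst p) v))" for u v
    by (simp add: B'_def bilinear_radd[OF Gb] bilinear_rmul[OF Gb] algebra_simps)
  show ?thesis unfolding e codazzi_shape[OF p, of u v] Gamma_sym[OF p, of u v] ..
qed

lemma B_B'_adjoint:
  assumes p: "fst p \<in> U"
  shows "g (fst p) (B' p u) (B p v) = g (fst p) (B' p v) (B p u)"
proof -
  note b = bil[OF p]
  have sym: "g (fst p) v u = g (fst p) u v" "g (fst p) v (S (fst p) u) = g (fst p) u (S (fst p) v)"
    "g (fst p) (S (fst p) w) z = g (fst p) w (S (fst p) z)" for w z
    using inner_form_sym[OF form[OF p]] shape_adjoint[OF p] by metis+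
  show ?thesis
    by (simp add: B_def B'_def bilinear_ladd[OF b] bilinear_radd[OF b] bilinear_lmul[OF b] bilinear_rmul[OF b]
        sym(3) shape_square[OF p] sym(1,2) algebra_simps)
qed

end

section \<open>Curvature of the cylinder metric\<close>

context minimal_germ_chart
begin

text \<open>
  Derivatives in the direction \<open>X\<close> of \<open>dB p Y u\<close> and of \<open>conn p Y P\<close>. In the first, \<open>B'' = B / 6\<close> enters
  through \<open>dB'\<close>.
\<close>

definition ddB :: "(real^2) \<times> real \<Rightarrow> (real^2) \<times> real \<Rightarrow> (real^2) \<times> real \<Rightarrow> real^2 \<Rightarrow> real^2" where
  "ddB p X Y u = snd Y *\<^sub>R dB' p X u
  + (sn (snd p) *\<^sub>R ddS (fst p) (fst X) (fst Y) u + (snd X * cs (snd p)) *\<^sub>R dS (fst p) (fst Y) u)"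

definition conn' :: "(real^2) \<times> real \<Rightarrow> (real^2) \<times> real \<Rightarrow> (real^2) \<times> real \<Rightarrow> (real^2) \<times> real \<Rightarrow> (real^2) \<times> real" where
  "conn' p X Y P = (dGamma (fst p) (fst X) (fst Y) (fst P) + snd P *\<^sub>R dB' p X (fst Y),
     - (g (fst p) (Gam (fst p) (fst X) (B' p (fst Y))) (fst P) + g (fst p) (B' p (fst Y)) (Gam (fst p) (fst X) (fst P))
       + g (fst p) (dB' p X (fst Y)) (fst P)))"

lemma open_cylinder: "open (U \<times> (UNIV :: real set))"
  using U by (simp add: open_Times)

lemma deriv_dB: "fst p \<in> U \<Longrightarrow> ((\<lambda>p. dB p Y u) has_derivative (\<lambda>X. ddB p X Y u)) (at p)"
  unfolding dB_def ddB_def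
  by (intro has_derivative_add has_derivative_scaleR has_derivative_scaleR_right deriv_B' has_derivative_sn
      has_derivative_on_fst deriv_dS)

lemma deriv_Gam_family:
  fixes p :: "(real^2) \<times> real"
  assumes p: "fst p \<in> U" and q: "(q has_derivative q') (at p)"
  shows "((\<lambda>p. Gam (fst p) u (q p)) has_derivative (\<lambda>X. dGamma (fst p) (fst X) u (q p) + Gam (fst p) u (q' X))) (at p)"
  by (rule has_derivative_linear_family[OF open_cylinder, where L = "\<lambda>p. Gam (fst p) u" and L' = "\<lambda>X w. dGamma (fst p) (fst X) u w"])
    (auto simp: p q mem_Times_iff intro!: bilinear_linear(1)[OF Gamma_bilinear] has_derivative_on_fst deriv_Gamma)

lemma deriv_g_family:
  fixes p :: "(real^2) \<times> real"
  assumes p: "fst p \<in> U" and q: "(q has_derivative q') (at p)" and r: "(r has_derivative r') (at p)"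
  shows "((\<lambda>p. g (fst p) (q p) (r p)) has_derivative (\<lambda>X. g (fst p) (Gam (fst p) (fst X) (q p)) (r p)
      + g (fst p) (q p) (Gam (fst p) (fst X) (r p)) + g (fst p) (q' X) (r p) + g (fst p) (q p) (r' X))) (at p)"
  by (rule has_derivative_bilinear_family[OF open_cylinder, where G = "\<lambda>p. g (fst p)"
        and G' = "\<lambda>X v w. g (fst p) (Gam (fst p) (fst X) v) w + g (fst p) v (Gam (fst p) (fst X) w)"])
    (auto simp: p q r bil mem_Times_iff intro!: has_derivative_on_fst[where f = "\<lambda>x. g x _ _"] deriv_g)

lemma deriv_frame: "fst p \<in> U \<Longrightarrow> ((\<lambda>p. frame p Y) has_derivative (\<lambda>X. (dB p X (fst Y), 0))) (at p)"
  unfolding frame_def by (intro has_derivative_Pair deriv_B has_derivative_const)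

lemma deriv_frame': "fst p \<in> U \<Longrightarrow> ((\<lambda>p. (dB p Y (fst W), 0 :: real)) has_derivative (\<lambda>X. (ddB p X Y (fst W), 0))) (at p)"
  by (intro has_derivative_Pair deriv_dB has_derivative_const)

text \<open>
  The off-diagonal part of the connection is skew for \<open>g + dt\<^sup>2\<close>, and \<open>\<Gamma>\<close> is metric for \<open>g\<close>.
\<close>

lemma conn_metric:
  assumes p: "fst p \<in> U"
  shows "((\<lambda>p. fibre_metric p P Q) has_derivative
     (\<lambda>X. fibre_metric p (conn p X P) Q + fibre_metric p P (conn p X Q))) (at p)"
proof -
  note b = bil[OF p]
  have "((\<lambda>p. g (fst p) (fst P) (fst Q) + snd P * snd Q) has_derivative (\<lambda>X.
      (g (fst p) (Gam (fst p) (fst X) (fst P)) (fst Q) + g (fst p) (fst P) (Gam (fst p) (fst X) (fst Q))) + 0)) (at p)"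
    by (intro has_derivative_add has_derivative_const has_derivative_on_fst[where f = "\<lambda>x. g x _ _"] deriv_g p)
  moreover have "fibre_metric p (conn p X P) Q + fibre_metric p P (conn p X Q) =
      g (fst p) (Gam (fst p) (fst X) (fst P)) (fst Q) + g (fst p) (fst P) (Gam (fst p) (fst X) (fst Q))" for X
    by (simp add: fibre_metric_def conn_def bilinear_ladd[OF b] bilinear_radd[OF b] bilinear_lmul[OF b]
        bilinear_rmul[OF b] inner_form_sym[OF form[OF p], of "fst P" "B' p (fst X)"] algebra_simps)
  ultimately show ?thesis unfolding fibre_metric_def by simp
qed

lemma conn_linear: "fst p \<in> U \<Longrightarrow> linear (conn p X)"
proof -
  assume p: "fst p \<in> U"
  note b = bil[OF p] and Gb = Gamma_bilinear[OF p]
  show ?thesis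
    by (rule linearI)
      (simp_all add: conn_def bilinear_radd[OF b] bilinear_rmul[OF b] bilinear_radd[OF Gb] bilinear_rmul[OF Gb]
        algebra_simps)
qed

lemma deriv_conn: "fst p \<in> U \<Longrightarrow> ((\<lambda>p. conn p Y P) has_derivative (\<lambda>X. conn' p X Y P)) (at p)"
proof -
  assume p: "fst p \<in> U"
  have "((\<lambda>p. g (fst p) (B' p (fst Y)) (fst P)) has_derivative (\<lambda>X.
      g (fst p) (Gam (fst p) (fst X) (B' p (fst Y))) (fst P) + g (fst p) (B' p (fst Y)) (Gam (fst p) (fst X) (fst P))
       + g (fst p) (dB' p X (fst Y)) (fst P))) (at p)"
    using deriv_g_family[OF p deriv_B'[OF p, of "fst Y"] has_derivative_const[of "fst P"]]
    by (simp add: bilinear_rzero[OF bil[OF p]])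
  then show ?thesis
    unfolding conn_def conn'_def
    by (intro has_derivative_Pair has_derivative_add has_derivative_minus has_derivative_scaleR_right
        deriv_B' p has_derivative_on_fst[where f = "\<lambda>x. Gam x _ _"] deriv_Gamma)
qed

definition frame_deriv :: "(real^2) \<times> real \<Rightarrow> (real^2) \<times> real \<Rightarrow> (real^2) \<times> real \<Rightarrow> (real^2) \<times> real" where
  "frame_deriv p X Y = (dB p X (fst Y), 0) + conn p X (frame p Y)"

text \<open>
  Vanishing torsion: the tangential component is the Codazzi property of \<open>B\<close>, the normal component is
  symmetry of \<open>B'B\<close>, a polynomial in \<open>S\<close>.
\<close>

lemma frame_deriv_sym:
  assumes p: "fst p \<in> U"
  shows "frame_deriv p X Y = frame_deriv p Y X"
proof (rule prod_eqI)
  show "snd (frame_deriv p X Y) = snd (frame_deriv p Y X)"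
    using B_B'_adjoint[OF p] by (simp add: frame_deriv_def conn_def frame_def)
  have "fst (frame_deriv p X Y) = snd X *\<^sub>R B' p (fst Y) + snd Y *\<^sub>R B' p (fst X)
      + (sn (snd p) *\<^sub>R dS (fst p) (fst X) (fst Y) + Gam (fst p) (fst X) (B p (fst Y)))" for X Y
    by (simp add: frame_deriv_def conn_def frame_def dB_def)
  then show "fst (frame_deriv p X Y) = fst (frame_deriv p Y X)"
    using codazzi_B[OF p, of "fst X" "fst Y"] by simp
qed

definition Gamma_h :: "(real^2) \<times> real \<Rightarrow> (real^2) \<times> real \<Rightarrow> (real^2) \<times> real \<Rightarrow> (real^2) \<times> real" where
  "Gamma_h p X Y = (inverse (detB p) *\<^sub>R (cs (snd p) *\<^sub>R fst (frame_deriv p X Y)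
       - sn (snd p) *\<^sub>R S (fst p) (fst (frame_deriv p X Y))), snd (frame_deriv p X Y))"

lemma frame_Gamma_h: "p \<in> V \<Longrightarrow> frame p (Gamma_h p X Y) = frame_deriv p X Y"
proof -
  assume p: "p \<in> V"
  then have "detB p \<noteq> 0" using region_D(2)[of p] by simp
  then show ?thesis using B_inverse[OF region_D(1)[OF p]] by (simp add: frame_def Gamma_h_def)
qed

lemma christoffel_h: "p \<in> V \<Longrightarrow> christoffel h p X Y = Gamma_h p X Y"
proof -
  assume p: "p \<in> V"
  show ?thesis
  proof (rule frame_christoffel[OF open_V p, where \<Phi> = frame and G = fibre_metric and \<omega> = "conn p"
        and \<Phi>' = "\<lambda>X Y. (dB p X (fst Y), 0)"])
    show "frame p (Gamma_h p X Y) = (dB p X (fst Y), 0) + conn p X (frame p Y)"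
      unfolding frame_Gamma_h[OF p] frame_deriv_def ..
    show "(dB p X (fst Y), 0) + conn p X (frame p Y) = (dB p Y (fst X), 0) + conn p Y (frame p X)" for X Y
      using frame_deriv_sym[OF region_D(1)[OF p]] by (simp add: frame_deriv_def)
  qed (rule deriv_frame conn_metric fibre_metric_form frame_linear frame_inj h_frame; simp add: p region_D(1))+
qed

lemma Gamma_h_differentiable: "p \<in> V \<Longrightarrow> (\<lambda>p. Gamma_h p X Y) differentiable (at p)"
proof -
  assume pV: "p \<in> V"
  note p = region_D(1)[OF pV]
  have det: "detB p \<noteq> 0" using region_D(2)[OF pV] by simp
  let ?K1 = "\<lambda>p. dB p X (fst Y) + (Gam (fst p) (fst X) (B p (fst Y)) + snd Y *\<^sub>R B' p (fst X))"
  let ?K2 = "\<lambda>p. - g (fst p) (B' p (fst X)) (B p (fst Y))"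
  obtain K1' where K1: "(?K1 has_derivative K1') (at p)"
    by (rule that, rule has_derivative_add[OF deriv_dB[OF p] has_derivative_add[OF
          deriv_Gam_family[OF p deriv_B[OF p]] has_derivative_scaleR_right[OF deriv_B'[OF p]]]])
  obtain K2' where K2: "(?K2 has_derivative K2') (at p)"
    by (rule that, rule has_derivative_minus[OF deriv_g_family[OF p deriv_B'[OF p] deriv_B[OF p]]])
  obtain D' where D: "(detB has_derivative D') (at p)"
    using detB_differentiable[OF p] unfolding differentiable_def by blast
  have SK1: "((\<lambda>p. S (fst p) (?K1 p)) has_derivative (\<lambda>Z. dS (fst p) (fst Z) (?K1 p) + S (fst p) (K1' Z))) (at p)"
    by (rule has_derivative_linear_family[OF open_cylinder, where L = "\<lambda>p. S (fst p)" and L' = "\<lambda>X w. dS (fst p) (fst X) w"])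
      (auto simp: p K1 mem_Times_iff intro!: shape_linear has_derivative_on_fst deriv_S)
  have "(\<lambda>p. (inverse (detB p) *\<^sub>R (cs (snd p) *\<^sub>R ?K1 p - sn (snd p) *\<^sub>R S (fst p) (?K1 p)), ?K2 p)) differentiable (at p)"
    by (rule differentiableI, rule has_derivative_Pair[OF has_derivative_scaleR[OF
          Deriv.has_derivative_inverse[OF det D] has_derivative_diff[OF has_derivative_scaleR[OF has_derivative_cs K1]
          has_derivative_scaleR[OF has_derivative_sn SK1]]] K2])
  then show ?thesis by (simp add: Gamma_h_def[abs_def] frame_deriv_def conn_def frame_def)
qed

lemma wedge_combination:
  fixes a b :: real
  assumes x: "x \<in> U"
  defines "T \<equiv> \<lambda>u. a *\<^sub>R u + b *\<^sub>R S x u"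
  shows "g x (T v) w *\<^sub>R T u - g x (T u) w *\<^sub>R T v = (a\<^sup>2 - lam x * b\<^sup>2) *\<^sub>R (g x v w *\<^sub>R u - g x u w *\<^sub>R v)"
proof -
  note b = bil[OF x]
  note wedge = plane_traceless_wedge[OF shape_linear[OF x] shape_traceless[OF x] shape_square[OF x]
      bilinear_linear(2)[OF b, of w], of v u]
  have "g x (T v) w *\<^sub>R T u - g x (T u) w *\<^sub>R T v = a\<^sup>2 *\<^sub>R (g x v w *\<^sub>R u - g x u w *\<^sub>R v)
     + (a * b) *\<^sub>R (g x v w *\<^sub>R S x u - g x (S x u) w *\<^sub>R v + (g x (S x v) w *\<^sub>R u - g x u w *\<^sub>R S x v))
     + b\<^sup>2 *\<^sub>R (g x (S x v) w *\<^sub>R S x u - g x (S x u) w *\<^sub>R S x v)"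
    by (simp add: T_def bilinear_ladd[OF b] bilinear_lmul[OF b] power2_eq_square algebra_simps)
  then show ?thesis unfolding wedge by (simp add: algebra_simps)
qed

text \<open>
  The Gauss equation of the slices. With \<open>A = u \<and> v\<close>, the hypothesis on the scalar curvature of \<open>g\<close> says
  \<open>R(u,v) = (-1/6 - \<lambda>) A\<close>, and \<open>Bu \<and> Bv = (cs\<^sup>2 - \<lambda> sn\<^sup>2) A\<close>, \<open>B'u \<and> B'v = (sn\<^sup>2/36 - \<lambda> cs\<^sup>2) A\<close>. The
  three coefficients match because of \<open>cs\<^sup>2 - sn\<^sup>2/6 = 1\<close>; this is where the constants in the germ
  equations are used.
\<close>

lemma gauss_wedge:
  assumes p: "fst p \<in> U"
  shows "riemann g (fst p) u v w - g (fst p) (B' p v) w *\<^sub>R B' p u + g (fst p) (B' p u) w *\<^sub>R B' p v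
     = (- 1 / 6) *\<^sub>R (g (fst p) (B p v) w *\<^sub>R B p u - g (fst p) (B p u) w *\<^sub>R B p v)"
proof -
  define A where "A = g (fst p) v w *\<^sub>R u - g (fst p) u w *\<^sub>R v"
  define c s l where "c = cs (snd p)" "s = sn (snd p)" "l = lam (fst p)"
  have B: "g (fst p) (B p v) w *\<^sub>R B p u - g (fst p) (B p u) w *\<^sub>R B p v = (c\<^sup>2 - l * s\<^sup>2) *\<^sub>R A"
    unfolding B_def A_def c_s_l_def by (rule wedge_combination[OF p])
  have B': "g (fst p) (B' p v) w *\<^sub>R B' p u - g (fst p) (B' p u) w *\<^sub>R B' p v = ((s / 6)\<^sup>2 - l * c\<^sup>2) *\<^sub>R A"
    unfolding B'_def A_def c_s_l_def by (rule wedge_combination[OF p])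
  have R: "riemann g (fst p) u v w = (- 1 / 6 - l) *\<^sub>R A"
    unfolding gauss_curvature[OF p] curvature[OF p] A_def c_s_l_def ..
  have c2: "c\<^sup>2 = 1 + s\<^sup>2 / 6" using cs_sn_pythagoras[of "snd p"] by (simp add: c_s_l_def)
  have "(- 1 / 6 - l) - ((s / 6)\<^sup>2 - l * c\<^sup>2) = (- 1 / 6) * (c\<^sup>2 - l * s\<^sup>2)"
    unfolding c2 by (simp add: power2_eq_square field_simps)
  then have "(- 1 / 6 - l) *\<^sub>R A - ((s / 6)\<^sup>2 - l * c\<^sup>2) *\<^sub>R A = (- 1 / 6) *\<^sub>R (c\<^sup>2 - l * s\<^sup>2) *\<^sub>R A"
    by (simp only: scaleR_left_diff_distrib[symmetric] scaleR_scaleR)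
  then show ?thesis unfolding R[symmetric] B[symmetric] B'[symmetric] by (simp only: diff_diff_eq2 diff_add_eq)
qed

lemma codazzi_dB':
  assumes p: "fst p \<in> U"
  shows "dB' p X (fst Y) + Gam (fst p) (fst X) (B' p (fst Y)) - (dB' p Y (fst X) + Gam (fst p) (fst Y) (B' p (fst X)))
    = (snd X / 6) *\<^sub>R B p (fst Y) - (snd Y / 6) *\<^sub>R B p (fst X)"
  using codazzi_B'[OF p, of "fst X" "fst Y"] by (simp add: dB'_def algebra_simps)

text \<open>
  The tangential part of the curvature is the Gauss equation; the mixed part reduces by the Codazzi
  property of \<open>B'\<close> to the radial term \<open>B'' = B / 6\<close>. Together they say that the connection has
  constant curvature \<open>-1/6\<close> with respect to the frame.
\<close>

lemma conn_curvature:
  assumes p: "fst p \<in> U"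
  shows "conn' p X Y P - conn' p Y X P + conn p X (conn p Y P) - conn p Y (conn p X P)
    = (- 1 / 6) *\<^sub>R (fibre_metric p (frame p Y) P *\<^sub>R frame p X - fibre_metric p (frame p X) P *\<^sub>R frame p Y)"
    (is "?L = ?R")
proof (rule prod_eqI)
  note b = bil[OF p] and Gb = Gamma_bilinear[OF p]
  let ?g = "g (fst p)" and ?G = "Gam (fst p)"
  obtain u a v c w q where XYP: "X = (u, a)" "Y = (v, c)" "P = (w, q)" by (metis prod.exhaust)
  define E where "E = dB' p X v + ?G u (B' p v) - (dB' p Y u + ?G v (B' p u))"
  have E: "E = (a / 6) *\<^sub>R B p v - (c / 6) *\<^sub>R B p u"
    using codazzi_dB'[OF p, of X Y] by (simp add: E_def XYP)
  have R: "riemann g (fst p) u v w = dGamma (fst p) u v w - dGamma (fst p) v u w + ?G u (?G v w) - ?G v (?G u w)"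
    by (simp add: riemann_def dGamma_def)
  have "fst ?L = (riemann g (fst p) u v w - ?g (B' p v) w *\<^sub>R B' p u + ?g (B' p u) w *\<^sub>R B' p v) + q *\<^sub>R E"
    by (simp add: R conn_def conn'_def XYP E_def bilinear_radd[OF Gb] bilinear_rmul[OF Gb] algebra_simps)
  also have "\<dots> = fst ?R"
    unfolding gauss_wedge[OF p] E
    by (simp add: XYP fibre_metric_def frame_def algebra_simps add_divide_distrib)
  finally show "fst ?L = fst ?R" .
  have "snd ?L = - ?g E w"
    by (simp add: conn_def conn'_def XYP E_def bilinear_radd[OF b] bilinear_rmul[OF b] bilinear_ladd[OF b]
        bilinear_lsub[OF b] inner_form_sym[OF form[OF p], of "B' p v" "B' p u"] algebra_simps)
  also have "\<dots> = snd ?R"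
    unfolding E
    by (simp add: XYP fibre_metric_def frame_def bilinear_lsub[OF b] bilinear_lmul[OF b] algebra_simps)
  finally show "snd ?L = snd ?R" .
qed

lemma riemann_h:
  assumes p: "p \<in> V"
  shows "riemann h p X Y Z = (- 1 / 6) *\<^sub>R (h p Y Z *\<^sub>R X - h p X Z *\<^sub>R Y)"
proof -
  note pU = region_D(1)[OF p]
  have "frame p (riemann h p X Y Z) = conn' p X Y (frame p Z) - conn' p Y X (frame p Z)
      + conn p X (conn p Y (frame p Z)) - conn p Y (conn p X (frame p Z))"
  proof (rule frame_riemann[OF open_V p, where \<Phi>' = "\<lambda>p X Y. (dB p X (fst Y), 0)"
        and \<Phi>'' = "\<lambda>X Y W. (ddB p X Y (fst W), 0)"])
    show "(\<lambda>y. christoffel h y X Y) differentiable (at p)" for X Y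
    proof -
      obtain D where "((\<lambda>y. Gamma_h y X Y) has_derivative D) (at p)"
        using Gamma_h_differentiable[OF p] unfolding differentiable_def by blast
      then have "((\<lambda>y. christoffel h y X Y) has_derivative D) (at p)"
        by (rule has_derivative_transform_within_open[OF _ open_V p]) (simp add: christoffel_h)
      then show ?thesis by (rule differentiableI)
    qed
    show "frame y (christoffel h y X Y) = (dB y X (fst Y), 0) + conn y X (frame y Y)" if "y \<in> V" for y X Y
      using that by (simp add: christoffel_h frame_Gamma_h frame_deriv_def)
  qed (rule frame_linear conn_linear deriv_frame deriv_frame' deriv_conn; simp add: p region_D(1))+
  also have "\<dots> = frame p ((- 1 / 6) *\<^sub>R (h p Y Z *\<^sub>R X - h p X Z *\<^sub>R Y))"
    unfolding conn_curvature[OF pU] h_frame[OF p]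
    by (simp only: linear_cmul[OF frame_linear[OF p]] linear_diff[OF frame_linear[OF p]])
  finally show ?thesis using frame_inj[OF p] by (simp add: inj_eq)
qed

lemma h_sectional: "p \<in> V \<Longrightarrow> X \<noteq> Y \<Longrightarrow> independent {X, Y} \<Longrightarrow> sectional_curvature h p X Y = - 1 / 6"
  by (rule constant_curvature_sectional[where h = h and x = p, OF h_form riemann_h])

lemma h_scalar: "p \<in> V \<Longrightarrow> scalar_curvature h p = - 1"
  using constant_curvature_scalar[where h = h and x = p, OF h_form riemann_h] by simp

lemma Ck_h: "Ck_on k V (\<lambda>p. h p X Y)"
proof -
  note O = open_V
  have f: "Ck_on k V (\<lambda>p. f (fst p))" if "Ck_on k U f" for f :: "real^2 \<Rightarrow> real"
    by (rule Ck_on_compose_linear[OF O bounded_linear_fst _ that]) (rule region_D(1))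
  have c: "Ck_on k V (\<lambda>p. cs (snd p))" "Ck_on k V (\<lambda>p. sn (snd p))"
    using Ck_on_cs_sn by (auto intro: Ck_on_compose_linear[OF O bounded_linear_snd])
  show ?thesis
    unfolding cylinder_metric_def power2_eq_square
    by (intro Ck_on_add Ck_on_mult Ck_on_const O c f[OF Ck_g] f[OF Ck_m]
        f[OF Ck_lam])
qed

lemma slice_V: "x \<in> U \<Longrightarrow> (x, 0) \<in> V"
  by (simp add: nondegenerate_region_def cs_sn_0)

lemma h_slice: "h (x, 0) X Y = g x (fst X) (fst Y) + snd X * snd Y"
  by (simp add: cylinder_metric_def cs_sn_0)

lemma first_ff_h: "first_ff h x u v = g x u v"
  by (simp add: first_ff_def h_slice)

lemma unit_normal_h:
  assumes x: "x \<in> U" shows "unit_normal h x = (0, 1)"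
  unfolding unit_normal_def
proof (rule the_equality)
  show "(\<forall>u. h (x, 0) (0, 1) (u, 0) = 0) \<and> h (x, 0) (0, 1) (0, 1) = 1 \<and> snd (0 :: real^2, 1 :: real) > 0"
    by (simp add: h_slice bilinear_lzero[OF bil[OF x]])
  fix \<nu> assume \<nu>: "(\<forall>u. h (x, 0) \<nu> (u, 0) = 0) \<and> h (x, 0) \<nu> \<nu> = 1 \<and> snd \<nu> > 0"
  then have "g x (fst \<nu>) (fst \<nu>) = 0" by (auto simp: h_slice)
  then have 0: "fst \<nu> = 0" using inner_form_pos[OF form[OF x], of "fst \<nu>"] by force
  then have "snd \<nu> * snd \<nu> = 1" using \<nu> by (simp add: h_slice bilinear_lzero[OF bil[OF x]])
  then have "snd \<nu> = 1" using \<nu> by (metis abs_of_pos abs_square_eq_1 power2_eq_square)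
  with 0 show "\<nu> = (0, 1)" by (simp add: prod_eq_iff)
qed

lemma second_ff_h:
  assumes x: "x \<in> U" shows "second_ff h x u v = m x u v"
proof -
  have "snd (christoffel h (x, 0) (u, 0) (v, 0)) = - m x u v"
    by (simp add: christoffel_h[OF slice_V[OF x]] Gamma_h_def frame_deriv_def conn_def frame_def B_def B'_def
        cs_sn_0 shape[OF x])
  then show ?thesis
    by (simp add: second_ff_def unit_normal_h[OF x] h_slice bilinear_rzero[OF bil[OF x]])
qed

end

section \<open>The hyperbolic neighbourhood of the surface\<close>

text \<open>
  The differential of a transition map conjugates the shape operators, hence preserves the scalar
  \<open>S\<^sup>2\<close>.
\<close>

lemma half_norm_sq_invariant:
  assumes "minimal_germ_chart U g m" "minimal_germ_chart U' g' m'" and x: "x \<in> U" and y: "y \<in> U'"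
    and J: "linear J"
    and g: "\<And>u v. g x u v = g' y (J u) (J v)" and m: "\<And>u v. m x u v = m' y (J u) (J v)"
  shows "half_norm_sq g m x = half_norm_sq g' m' y"
proof -
  interpret a: minimal_germ_chart U g m by fact
  interpret b: minimal_germ_chart U' g' m' by fact
  have J0: "J u \<noteq> 0" if "u \<noteq> 0" for u
  proof
    assume "J u = 0"
    then have "g x u u = 0" by (simp add: g bilinear_lzero[OF b.bil[OF y]])
    then show False using inner_form_pos[OF a.form[OF x] that] by simp
  qed
  then have "surj J" using J linear_injective_0 linear_injective_imp_surjective by blast
  have conj: "J (a.S x u) = b.S y (J u)" for u
  proof (rule inner_form_eqI[OF b.form[OF y]])
    fix z
    obtain w where w: "z = J w" using \<open>surj J\<close> by (metis surjD)
    show "g' y (J (a.S x u)) z = g' y (b.S y (J u)) z"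
      by (simp add: w g[symmetric] a.shape[OF x] b.shape[OF y] m)
  qed
  have "a.lam x *\<^sub>R J (axis 1 1) = J (a.S x (a.S x (axis 1 1)))"
    by (simp add: a.shape_square[OF x] linear_cmul[OF J])
  also have "\<dots> = b.lam y *\<^sub>R J (axis 1 1)"
    by (simp add: conj b.shape_square[OF y])
  finally show ?thesis using J0[of "axis 1 1"] by (simp add: axis_eq_0_iff)
qed

text \<open>
  A tensor field is indexed by charts, so the chart of the surface has to be recovered from a chart of
  the neighbourhood. This is possible because the neighbourhood contains the whole slice \<open>t = 0\<close>.
\<close>

definition base_chart :: "('p \<times> real, 'e \<times> real) chart \<Rightarrow> ('p, 'e) chart" where
  "base_chart C = (fst ` chart_dom C, \<lambda>p. fst (chart_map C (p, 0)))"

lemma base_chart_cylinder: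
  assumes "chart_dom c \<times> {0} \<subseteq> W"
  shows "base_chart (restrict_chart W (cylinder_chart c)) = c"
proof -
  have "fst ` ((chart_dom c \<times> UNIV) \<inter> W) = chart_dom c" using assms by force
  then show ?thesis by (simp add: base_chart_def restrict_chart_def cylinder_chart_def prod_eq_iff)
qed

locale hyperbolic_germ_surface =
  fixes X :: "'p topology" and A :: "('p, real^2) chart set" and g m :: "('p, real^2) tensor2"
  assumes manifold: "smooth_manifold X A" and germ: "minimal_hyperbolic_germ A g m"
begin

lemma chart: "c \<in> A \<Longrightarrow> openin X (chart_dom c)" "c \<in> A \<Longrightarrow> open (chart_range c)"
  "c \<in> A \<Longrightarrow> homeomorphic_map (subtopology X (chart_dom c)) (top_of_set (chart_range c)) (chart_map c)"
  using manifold by (auto simp: smooth_manifold_def is_chart_def)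

lemma chart_subset: "c \<in> A \<Longrightarrow> chart_dom c \<subseteq> topspace X"
  using chart(1) openin_subset by blast

lemma chart_inj: "c \<in> A \<Longrightarrow> inj_on (chart_map c) (chart_dom c)"
  using homeomorphic_imp_injective_map[OF chart(3)] chart_subset by (simp add: Int_absorb1)

lemma chart_mem: "p \<in> chart_dom c \<Longrightarrow> chart_map c p \<in> chart_range c"
  by (simp add: chart_range_def)

lemma germ_chart: "c \<in> A \<Longrightarrow> minimal_germ_chart (chart_range c) (g c) (m c)"
proof -
  assume c: "c \<in> A"
  have G: "riemannian_metric A g" "smooth_tensor2 A m" "symmetric_tensor2 A m"
    using germ by (auto simp: minimal_hyperbolic_germ_def)
  show ?thesis
  proof
    show "inner_form (g c x)" if "x \<in> chart_range c" for x
      using G(1) c that by (simp add: riemannian_metric_def smooth_tensor2_def symmetric_tensor2_def inner_form_def)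
    show "Ck_on k (chart_range c) (\<lambda>x. g c x u v)" for k u v
      using G(1) c by (simp add: riemannian_metric_def smooth_tensor2_def smooth_on_def)
    show "Ck_on k (chart_range c) (\<lambda>x. m c x u v)" for k u v
      using G(2) c by (simp add: smooth_tensor2_def smooth_on_def)
    show "bilinear (m c x)" if "x \<in> chart_range c" for x
      using G(2) c that by (simp add: smooth_tensor2_def)
    show "m c x u v = m c x v u" if "x \<in> chart_range c" for x u v
      using G(3) c that by (simp add: symmetric_tensor2_def)
    show "cov_deriv (g c) (m c) x w u v = cov_deriv (g c) (m c) x u w v" if "x \<in> chart_range c" for x w u v
      using germ c that by (simp add: minimal_hyperbolic_germ_def)
    show "scalar_curvature (g c) x + tensor_norm_sq (g c) (m c) x + 1 / 3 = 0"
      "metric_trace (g c) (m c) x = 0" if "x \<in> chart_range c" for x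
      using germ c that by (simp_all add: minimal_hyperbolic_germ_def)
  qed (rule chart(2)[OF c])
qed

lemma transition_eq: "c \<in> A \<Longrightarrow> p \<in> chart_dom c \<Longrightarrow> transition c d (chart_map c p) = chart_map d p"
  by (simp add: transition_def inv_into_f_f[OF chart_inj])

lemma open_overlap: "c \<in> A \<Longrightarrow> d \<in> A \<Longrightarrow> open (overlap c d)"
proof -
  assume c: "c \<in> A" and d: "d \<in> A"
  have "openin (subtopology X (chart_dom c)) (chart_dom c \<inter> chart_dom d)"
    using chart(1)[OF d] by (metis inf_commute openin_subtopology_Int)
  then have "openin (top_of_set (chart_range c)) (overlap c d)"
    using homeomorphic_imp_open_map[OF chart(3)[OF c]] unfolding overlap_def open_map_def by blast
  then show ?thesis using chart(2)[OF c] by (metis openin_open_trans)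
qed

lemma overlap_range: "overlap c d \<subseteq> chart_range c"
  by (auto simp: overlap_def chart_range_def)

abbreviation "jac c d x \<equiv> frechet_derivative (transition c d) (at x)"

lemma transition_deriv:
  assumes "c \<in> A" "d \<in> A" "x \<in> overlap c d"
  shows "(transition c d has_derivative jac c d x) (at x)"
proof (rule Ck_on_Suc_derivative[OF _ assms(3)])
  show "Ck_on (Suc 0) (overlap c d) (transition c d)"
    using manifold assms by (simp add: smooth_manifold_def smooth_on_def del: Ck_on.simps)
qed

lemma tensor_transition:
  assumes "c \<in> A" "d \<in> A" "x \<in> overlap c d"
  shows "g c x u v = g d (transition c d x) (jac c d x u) (jac c d x v)"
    and "m c x u v = m d (transition c d x) (jac c d x u) (jac c d x v)"
  using germ assms by (simp_all add: minimal_hyperbolic_germ_def riemannian_metric_def smooth_tensor2_def)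

lemma half_norm_sq_transition:
  assumes "c \<in> A" "d \<in> A" "x \<in> overlap c d"
  shows "half_norm_sq (g c) (m c) x = half_norm_sq (g d) (m d) (transition c d x)"
proof (rule half_norm_sq_invariant[OF germ_chart germ_chart])
  show "transition c d x \<in> chart_range d"
    using assms by (auto simp: overlap_def transition_eq chart_mem)
  show "x \<in> chart_range c" by (rule subsetD[OF overlap_range assms(3)])
  show "linear (jac c d x)" using transition_deriv[OF assms] has_derivative_linear by blast
qed (use assms tensor_transition in auto)

abbreviation "V c \<equiv> nondegenerate_region (g c) (m c) (chart_range c)"

text \<open>
  The condition does not depend on the chart, by invariance of \<open>|m|\<^sup>2\<close>.
\<close>

definition W :: "('p \<times> real) set" where
  "W = {q. \<exists>c\<in>A. fst q \<in> chart_dom c \<and> (chart_map c (fst q), snd q) \<in> V c}"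

lemma W_iff:
  assumes c: "c \<in> A" and p: "p \<in> chart_dom c"
  shows "(p, t) \<in> W \<longleftrightarrow> (chart_map c p, t) \<in> V c"
proof
  assume "(p, t) \<in> W"
  then obtain d where d: "d \<in> A" "p \<in> chart_dom d" "(chart_map d p, t) \<in> V d" by (auto simp: W_def)
  have "chart_map c p \<in> overlap c d" using p d by (auto simp: overlap_def)
  from half_norm_sq_transition[OF c d(1) this] have "half_norm_sq (g c) (m c) (chart_map c p) = half_norm_sq (g d) (m d) (chart_map d p)"
    by (simp add: transition_eq[OF c p])
  then show "(chart_map c p, t) \<in> V c"
    using d(3) chart_mem[OF p] by (simp add: nondegenerate_region_def)
next
  assume "(chart_map c p, t) \<in> V c"
  then show "(p, t) \<in> W" using c p by (auto simp: W_def)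
qed

lemma openin_W: "openin (prod_topology X euclideanreal) W"
proof -
  let ?P = "\<lambda>c. {q \<in> topspace (prod_topology (subtopology X (chart_dom c)) euclideanreal).
      (chart_map c (fst q), snd q) \<in> V c}"
  have "openin (prod_topology X euclideanreal) (?P c)" if c: "c \<in> A" for c
  proof -
    let ?T = "prod_topology (subtopology X (chart_dom c)) euclideanreal"
    have "continuous_map (subtopology X (chart_dom c)) euclidean (chart_map c)"
      using homeomorphic_imp_continuous_map[OF chart(3)[OF c]] by (simp add: continuous_map_in_subtopology)
    then have "continuous_map ?T (prod_topology euclidean euclidean) (\<lambda>q. (chart_map c (fst q), snd q))"
      by (intro continuous_map_pairedI continuous_map_compose[OF continuous_map_fst, unfolded o_def] continuous_map_snd)
    then have "openin ?T (?P c)"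
      using minimal_germ_chart.open_V[OF germ_chart[OF c]]
      by (intro openin_continuous_map_preimage) (auto simp: open_openin[symmetric] euclidean_product_topology[symmetric])
    then have "openin (subtopology (prod_topology X euclideanreal) (chart_dom c \<times> UNIV)) (?P c)"
      by (simp add: prod_topology_subtopology)
    moreover have "openin (prod_topology X euclideanreal) (chart_dom c \<times> UNIV)"
      using chart(1)[OF c] by (simp add: openin_prod_Times_iff)
    ultimately show ?thesis by (rule openin_trans_full)
  qed
  then have "openin (prod_topology X euclideanreal) (\<Union>c\<in>A. ?P c)" by blast
  moreover have "q \<in> topspace (prod_topology (subtopology X (chart_dom c)) euclideanreal)
      \<longleftrightarrow> fst q \<in> chart_dom c" if "c \<in> A" for c and q :: "'p \<times> real"
    using chart_subset[OF that] by (simp add: mem_Times_iff) blast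
  then have "(\<Union>c\<in>A. ?P c) = W"
    unfolding W_def by blast
  ultimately show ?thesis by simp
qed

lemma slice_W: "topspace X \<times> {0} \<subseteq> W"
proof
  fix q assume "q \<in> topspace X \<times> {0 :: real}"
  then obtain p where p: "q = (p, 0)" "p \<in> topspace X" by auto
  then obtain c where c: "c \<in> A" "p \<in> chart_dom c" using manifold unfolding smooth_manifold_def by blast
  show "q \<in> W"
    unfolding p(1) W_iff[OF c] by (rule minimal_germ_chart.slice_V[OF germ_chart[OF c(1)] chart_mem[OF c(2)]])
qed

abbreviation "cyl c \<equiv> restrict_chart W (cylinder_chart c)"

lemma base_cyl: "c \<in> A \<Longrightarrow> base_chart (cyl c) = c"
  by (rule base_chart_cylinder) (use chart_subset slice_W in blast)

lemma range_cyl: "c \<in> A \<Longrightarrow> chart_range (cyl c) = V c"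
proof -
  assume c: "c \<in> A"
  have "q \<in> chart_range (cyl c)" if "q \<in> V c" for q
  proof -
    have "fst q \<in> chart_range c" using that by (simp add: nondegenerate_region_def)
    then obtain p where p: "p \<in> chart_dom c" "fst q = chart_map c p"
      unfolding chart_range_def by blast
    then have "(p, snd q) \<in> W" using that W_iff[OF c p(1), of "snd q"] by (simp flip: p(2))
    with p show ?thesis
      unfolding chart_range_def
      by (intro image_eqI[of _ _ "(p, snd q)"]) (simp_all add: restrict_chart_def cylinder_chart_def prod_eq_iff)
  qed
  then show ?thesis
    using W_iff[OF c] by (auto simp: chart_range_def restrict_chart_def cylinder_chart_def)
qed

lemma overlap_cyl:
  assumes c: "c \<in> A" and d: "d \<in> A"
  shows "overlap (cyl c) (cyl d) = V c \<inter> (overlap c d \<times> UNIV)"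
proof -
  have "q \<in> overlap (cyl c) (cyl d)" if q: "q \<in> V c" "fst q \<in> overlap c d" for q
  proof -
    obtain p where p: "p \<in> chart_dom c" "p \<in> chart_dom d" "fst q = chart_map c p"
      using q(2) unfolding overlap_def by blast
    then have "(p, snd q) \<in> W" using q(1) W_iff[OF c p(1), of "snd q"] by (simp flip: p(3))
    with p show ?thesis
      unfolding overlap_def
      by (intro image_eqI[of _ _ "(p, snd q)"]) (simp_all add: restrict_chart_def cylinder_chart_def prod_eq_iff)
  qed
  then show ?thesis
    using W_iff[OF c] by (auto simp: overlap_def restrict_chart_def cylinder_chart_def)
qed

lemma transition_cyl:
  assumes c: "c \<in> A" and q: "q \<in> overlap (cyl c) (cyl d)"
  shows "transition (cyl c) (cyl d) q = (transition c d (fst q), snd q)"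
proof -
  obtain p t where p: "(p, t) \<in> chart_dom (cyl c)" "q = (chart_map c p, t)"
    using q by (auto simp: overlap_def restrict_chart_def cylinder_chart_def)
  have "inj_on (chart_map (cyl c)) (chart_dom (cyl c))"
    unfolding restrict_chart_def cylinder_chart_def fst_conv snd_conv
    by (rule inj_on_subset[OF map_prod_inj_on[OF chart_inj[OF c] inj_on_id] Int_lower1])
  from inv_into_f_f[OF this p(1)] have "transition (cyl c) (cyl d) q = (chart_map d p, t)"
    by (simp add: transition_def p(2)) (simp add: restrict_chart_def cylinder_chart_def)
  moreover have "p \<in> chart_dom c" using p(1) by (simp add: restrict_chart_def cylinder_chart_def)
  ultimately show ?thesis by (simp add: p(2) transition_eq[OF c])
qed

lemma jac_cyl:
  assumes c: "c \<in> A" and d: "d \<in> A" and q: "q \<in> overlap (cyl c) (cyl d)"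
  shows "frechet_derivative (transition (cyl c) (cyl d)) (at q) Y = (jac c d (fst q) (fst Y), snd Y)"
proof -
  have o: "open (overlap (cyl c) (cyl d))"
    unfolding overlap_cyl[OF c d]
    by (intro open_Int open_Times open_UNIV open_overlap c d minimal_germ_chart.open_V[OF germ_chart])
  have "fst q \<in> overlap c d" using q by (auto simp: overlap_cyl[OF c d])
  from has_derivative_Pair[OF has_derivative_on_fst[OF transition_deriv[OF c d this]] has_derivative_snd[OF has_derivative_ident]]
  have "(transition (cyl c) (cyl d) has_derivative (\<lambda>Y. (jac c d (fst q) (fst Y), snd Y))) (at q)"
    by (rule has_derivative_transform_within_open[OF _ o q]) (simp add: transition_cyl[OF c])
  from frechet_derivative_at[OF this, symmetric] show ?thesis by (rule fun_cong)
qed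

definition H :: "('p \<times> real, (real^2) \<times> real) tensor2" where
  "H C = cylinder_metric (g (base_chart C)) (m (base_chart C))"

lemma H_cyl: "c \<in> A \<Longrightarrow> H (cyl c) = cylinder_metric (g c) (m c)"
  by (simp add: H_def base_cyl)

lemma H_transition:
  assumes c: "c \<in> A" and d: "d \<in> A" and q: "q \<in> overlap (cyl c) (cyl d)"
  shows "H (cyl c) q Y Z = H (cyl d) (transition (cyl c) (cyl d) q)
      (frechet_derivative (transition (cyl c) (cyl d)) (at q) Y)
      (frechet_derivative (transition (cyl c) (cyl d)) (at q) Z)"
proof -
  have f: "fst q \<in> overlap c d" using q by (auto simp: overlap_cyl[OF c d])
  show ?thesis
    unfolding H_cyl[OF c] H_cyl[OF d] transition_cyl[OF c q] jac_cyl[OF c d q] cylinder_metric_def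
    by (simp add: half_norm_sq_transition[OF c d f] tensor_transition[OF c d f])
qed

lemma H_smooth: "smooth_tensor2 (cyl ` A) H"
  unfolding smooth_tensor2_def
proof (intro conjI ballI allI)
  fix C assume "C \<in> cyl ` A"
  then obtain c where C: "C = cyl c" and c: "c \<in> A" by blast
  interpret M: minimal_germ_chart "chart_range c" "g c" "m c" by (rule germ_chart[OF c])
  show "bilinear (H C q)" if "q \<in> chart_range C" for q
    using that unfolding C H_cyl[OF c] range_cyl[OF c] by (intro inner_form_bilinear M.h_form)
  show "smooth_on (chart_range C) (\<lambda>q. H C q Y Z)" for Y Z
    unfolding C H_cyl[OF c] range_cyl[OF c] smooth_on_def by (intro allI M.Ck_h)
next
  fix C D q Y Z
  assume "C \<in> cyl ` A" "D \<in> cyl ` A" and q: "q \<in> overlap C D"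
  then obtain c d where C: "C = cyl c" "c \<in> A" and D: "D = cyl d" "d \<in> A" by blast
  show "H C q Y Z = H D (transition C D q) (frechet_derivative (transition C D) (at q) Y)
      (frechet_derivative (transition C D) (at q) Z)"
    using q unfolding C(1) D(1) by (rule H_transition[OF C(2) D(2)])
qed

lemma H_hyperbolic: "hyperbolic_metric (cyl ` A) H"
proof -
  have form: "inner_form (H (cyl c) q)" if "c \<in> A" "q \<in> V c" for c q
    unfolding H_cyl[OF that(1)] by (rule minimal_germ_chart.h_form[OF germ_chart[OF that(1)] that(2)])
  have sec: "sectional_curvature (H (cyl c)) q Y Z = - 1 / 6"
    if "c \<in> A" "q \<in> V c" "Y \<noteq> Z" "independent {Y, Z}" for c q Y Z
    unfolding H_cyl[OF that(1)] by (rule minimal_germ_chart.h_sectional[OF germ_chart[OF that(1)] that(2-4)])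
  have scal: "scalar_curvature (H (cyl c)) q = - 1" if "c \<in> A" "q \<in> V c" for c q
    unfolding H_cyl[OF that(1)] by (rule minimal_germ_chart.h_scalar[OF germ_chart[OF that(1)] that(2)])
  have "\<forall>C\<in>cyl ` A. \<forall>q\<in>chart_range C. \<forall>Y Z. H C q Y Z = H C q Z Y"
    using inner_form_sym[OF form] by (simp add: range_cyl)
  moreover have "\<forall>C\<in>cyl ` A. \<forall>q\<in>chart_range C. \<forall>Y. Y \<noteq> 0 \<longrightarrow> H C q Y Y > 0"
    using inner_form_pos[OF form] by (simp add: range_cyl)
  moreover have "\<forall>C\<in>cyl ` A. \<forall>q\<in>chart_range C. \<forall>Y Z. Y \<noteq> Z \<and> independent {Y, Z} \<longrightarrow>
      sectional_curvature (H C) q Y Z = - 1 / 6"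
    using sec by (simp add: range_cyl)
  moreover have "\<forall>C\<in>cyl ` A. \<forall>q\<in>chart_range C. scalar_curvature (H C) q = - 1"
    using scal by (simp add: range_cyl)
  moreover have "- 1 / 6 < (0 :: real)" by simp
  ultimately show ?thesis
    using H_smooth unfolding hyperbolic_metric_def riemannian_metric_def symmetric_tensor2_def by blast
qed

lemma fundamental_forms:
  assumes "c \<in> A" "x \<in> chart_range c"
  shows "first_ff (H (cyl c)) x u v = g c x u v" "second_ff (H (cyl c)) x u v = m c x u v"
  using assms by (simp_all add: H_cyl minimal_germ_chart.first_ff_h[OF germ_chart] minimal_germ_chart.second_ff_h[OF germ_chart])

end

theorem mainTheorem7:
  fixes \<Sigma> :: "'p topology"
    and A :: "('p, real^2) chart set"
    and g m :: "('p, real^2) tensor2"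
  assumes "closed_connected_oriented_surface \<Sigma> A"
    and "euler_characteristic \<Sigma> < 0"
    and "minimal_hyperbolic_germ A g m"
  shows "\<exists>(W :: ('p \<times> real) set) (h :: ('p \<times> real, (real^2) \<times> real) tensor2).
    openin (prod_topology \<Sigma> euclideanreal) W \<and>
    topspace \<Sigma> \<times> {0} \<subseteq> W \<and>
    hyperbolic_metric ((\<lambda>c. restrict_chart W (cylinder_chart c)) ` A) h \<and>
    (\<forall>c\<in>A. \<forall>x\<in>chart_range c. \<forall>u v.
      first_ff (h (restrict_chart W (cylinder_chart c))) x u v = g c x u v \<and>
      second_ff (h (restrict_chart W (cylinder_chart c))) x u v = m c x u v)"
proof -
  interpret S: hyperbolic_germ_surface \<Sigma> A g m
    using assms(1,3) unfolding closed_connected_oriented_surface_def by unfold_locales blast+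
  show ?thesis
    by (intro exI[of _ S.W] exI[of _ S.H] conjI ballI allI S.openin_W S.slice_W S.H_hyperbolic S.fundamental_forms)
qed

end
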